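(* Let $\mathbb{K}$ be a field of characteristic zero and let $H=(H,m,\Delta)$ be a graded connected bialgebra over $\mathbb{K}$ which is free as an associative unital algebra. Then the Lie algebra $\mathrm{Prim}(H)$ of primitive elements of $H$ is a free Lie algebra.
   Context: All vector spaces are over a field $\mathbb{K}$ of characteristic zero. Write $\mathbb{N}=\{0,1,2,\ldots\}$. A graded bialgebra is a bialgebra $(H,m,\Delta)$ (with unit $1_H$ and counit $\varepsilon$) together with a decomposition $H=\bigoplus_{n\in\mathbb{N}}H_n$ into subspaces such that $1_H\in H_0$, $m(H_k\otimes H_l)\subseteq H_{k+l}$ for all $k,l$, $\Delta(H_n)\subseteq\bigoplus_{p=0}^n H_p\otimes H_{n-p}$ for all $n$, and $\varepsilon(H_n)=(0)$ for all $n\geq 1$. It is connected if $H_0$ is one-dimensional (so $H_0=\mathbb{K}1_H$). The subspaces $H_n$ are not assumed to be finite-dimensional. $\mathrm{Prim}(H)=\{x\in H\mid \Delta(x)=x\otimes 1_H+1_H\otimes x\}$, with Lie bracket $[x,y]=xy-yx$. *)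

theory Defs
  imports Complex_Main "HOL-Library.Poly_Mapping"
begin

section \<open>Formal linear combinations\<close>

text \<open>
  The vector space with basis a type \<open>'x\<close> over a field \<open>'k\<close> is \<open>'x \<Rightarrow>\<^sub>0 'k\<close>; the basis vector of \<open>x\<close>
  is \<open>Poly_Mapping.single x 1\<close>.
\<close>

definition fscale :: "'k::field \<Rightarrow> ('x \<Rightarrow>\<^sub>0 'k) \<Rightarrow> ('x \<Rightarrow>\<^sub>0 'k)" where
  "fscale c p = Poly_Mapping.map ((*) c) p"

lemma lookup_fscale [simp]: "Poly_Mapping.lookup (fscale c p) x = c * Poly_Mapping.lookup p x"
  unfolding fscale_def by (simp add: Poly_Mapping.map.rep_eq when_def)

lemma vector_space_fscale: "vector_space (fscale :: 'k::field \<Rightarrow> ('x \<Rightarrow>\<^sub>0 'k) \<Rightarrow> _)"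
  by unfold_locales (auto intro!: poly_mapping_eqI simp: lookup_add algebra_simps)

text \<open>The linear, respectively bilinear, extension of a map given on basis vectors.\<close>

definition lin_ext :: "('k::field \<Rightarrow> 'v::ab_group_add \<Rightarrow> 'v) \<Rightarrow> ('x \<Rightarrow> 'v) \<Rightarrow> ('x \<Rightarrow>\<^sub>0 'k) \<Rightarrow> 'v" where
  "lin_ext s f p = (\<Sum>x\<in>Poly_Mapping.keys p. s (Poly_Mapping.lookup p x) (f x))"

definition bilin_ext :: "('x \<Rightarrow> 'y \<Rightarrow> 'z) \<Rightarrow> ('x \<Rightarrow>\<^sub>0 'k::field) \<Rightarrow> ('y \<Rightarrow>\<^sub>0 'k) \<Rightarrow> ('z \<Rightarrow>\<^sub>0 'k)" where
  "bilin_ext f p q = (\<Sum>x\<in>Poly_Mapping.keys p. \<Sum>y\<in>Poly_Mapping.keys q.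
     Poly_Mapping.single (f x y) (Poly_Mapping.lookup p x * Poly_Mapping.lookup q y))"

section \<open>Tensor products\<close>

text \<open>
  \<open>V \<otimes> W\<close> is the quotient of the vector space with basis \<open>V \<times> W\<close> by the subspace spanned by the
  bilinearity relations; its elements are cosets of that subspace. The tensor
  \<open>\<Sum>i. c\<^sub>i (a\<^sub>i \<otimes> b\<^sub>i)\<close> is the coset of the formal sum \<open>\<Sum>i. c\<^sub>i (a\<^sub>i, b\<^sub>i)\<close>. The space \<open>V \<otimes> V \<otimes> V\<close> is
  the analogous quotient of the vector space with basis \<open>V \<times> V \<times> V\<close> by the trilinearity relations.
\<close>

abbreviation bas :: "'x \<Rightarrow> ('x \<Rightarrow>\<^sub>0 'k::field)" where
  "bas x \<equiv> Poly_Mapping.single x 1"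

definition bilinear_relations ::
  "('k::field \<Rightarrow> 'v::ab_group_add \<Rightarrow> 'v) \<Rightarrow> ('k \<Rightarrow> 'w::ab_group_add \<Rightarrow> 'w) \<Rightarrow> ('v \<times> 'w \<Rightarrow>\<^sub>0 'k) set" where
  "bilinear_relations s1 s2 = module.span fscale (
      {bas (a + a', b) - bas (a, b) - bas (a', b) | a a' b. True}
    \<union> {bas (a, b + b') - bas (a, b) - bas (a, b') | a b b'. True}
    \<union> {bas (s1 c a, b) - fscale c (bas (a, b)) | c a b. True}
    \<union> {bas (a, s2 c b) - fscale c (bas (a, b)) | c a b. True})"

definition trilinear_relations ::
  "('k::field \<Rightarrow> 'v::ab_group_add \<Rightarrow> 'v) \<Rightarrow> ('v \<times> 'v \<times> 'v \<Rightarrow>\<^sub>0 'k) set" where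
  "trilinear_relations s = module.span fscale (
      {bas (a + a', b, d) - bas (a, b, d) - bas (a', b, d) | a a' b d. True}
    \<union> {bas (a, b + b', d) - bas (a, b, d) - bas (a, b', d) | a b b' d. True}
    \<union> {bas (a, b, d + d') - bas (a, b, d) - bas (a, b, d') | a b d d'. True}
    \<union> {bas (s c a, b, d) - fscale c (bas (a, b, d)) | c a b d. True}
    \<union> {bas (a, s c b, d) - fscale c (bas (a, b, d)) | c a b d. True}
    \<union> {bas (a, b, s c d) - fscale c (bas (a, b, d)) | c a b d. True})"

type_synonym ('k, 'v, 'w) tensor = "('v \<times> 'w \<Rightarrow>\<^sub>0 'k) set"

definition tensor_of ::
  "('k::field \<Rightarrow> 'v::ab_group_add \<Rightarrow> 'v) \<Rightarrow> ('k \<Rightarrow> 'w::ab_group_add \<Rightarrow> 'w)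
    \<Rightarrow> ('v \<times> 'w \<Rightarrow>\<^sub>0 'k) \<Rightarrow> ('k, 'v, 'w) tensor" where
  "tensor_of s1 s2 p = {q. q - p \<in> bilinear_relations s1 s2}"

definition tensor_space ::
  "('k::field \<Rightarrow> 'v::ab_group_add \<Rightarrow> 'v) \<Rightarrow> ('k \<Rightarrow> 'w::ab_group_add \<Rightarrow> 'w)
    \<Rightarrow> ('k, 'v, 'w) tensor set" where
  "tensor_space s1 s2 = range (tensor_of s1 s2)"

section \<open>Graded connected bialgebras\<close>

locale unital_algebra = vector_space scale
  for scale :: "'k::field \<Rightarrow> 'h::ring_1 \<Rightarrow> 'h" +
  assumes scale_mult_left: "scale c x * y = scale c (x * y)"
    and scale_mult_right: "x * scale c y = scale c (x * y)"

text \<open>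
  A map \<open>R\<close> with \<open>R a \<in> \<Delta> a\<close> chooses for each \<open>a\<close> a formal sum representing \<open>\<Delta> a\<close>. The maps
  \<open>\<Delta> \<otimes> id\<close> and \<open>id \<otimes> \<Delta>\<close> are computed with such a choice; modulo the trilinearity relations the
  result does not depend on it.
\<close>

definition apply_left ::
  "('v \<Rightarrow> ('v \<times> 'v \<Rightarrow>\<^sub>0 'k)) \<Rightarrow> ('v \<times> 'v \<Rightarrow>\<^sub>0 'k::field) \<Rightarrow> ('v \<times> 'v \<times> 'v \<Rightarrow>\<^sub>0 'k)" where
  "apply_left R = lin_ext fscale (\<lambda>(a, b). lin_ext fscale (\<lambda>(u, v). bas (u, v, b)) (R a))"

definition apply_right ::
  "('v \<Rightarrow> ('v \<times> 'v \<Rightarrow>\<^sub>0 'k)) \<Rightarrow> ('v \<times> 'v \<Rightarrow>\<^sub>0 'k::field) \<Rightarrow> ('v \<times> 'v \<times> 'v \<Rightarrow>\<^sub>0 'k)" where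
  "apply_right R = lin_ext fscale (\<lambda>(a, b). lin_ext fscale (\<lambda>(u, v). bas (a, u, v)) (R b))"

text \<open>
  Linearity of \<open>\<Delta>\<close>, its multiplicativity for the product \<open>(a \<otimes> b)(c \<otimes> d) = ac \<otimes> bd\<close>,
  coassociativity and the counit axioms are stated on representatives; each of these conditions
  depends only on the cosets.
\<close>

locale bialgebra = unital_algebra scale
  for scale :: "'k::field \<Rightarrow> 'h::ring_1 \<Rightarrow> 'h" +
  fixes \<Delta> :: "'h \<Rightarrow> ('k, 'h, 'h) tensor"
    and \<epsilon> :: "'h \<Rightarrow> 'k"
  assumes Delta_tensor: "\<Delta> x \<in> tensor_space scale scale"
    and Delta_add: "p \<in> \<Delta> x \<Longrightarrow> q \<in> \<Delta> y \<Longrightarrow> p + q \<in> \<Delta> (x + y)"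
    and Delta_scale: "p \<in> \<Delta> x \<Longrightarrow> fscale c p \<in> \<Delta> (scale c x)"
    and counit_add: "\<epsilon> (x + y) = \<epsilon> x + \<epsilon> y"
    and counit_scale: "\<epsilon> (scale c x) = c * \<epsilon> x"
    and coassoc: "(\<And>a. R a \<in> \<Delta> a) \<Longrightarrow> p \<in> \<Delta> x
          \<Longrightarrow> apply_left R p - apply_right R p \<in> trilinear_relations scale"
    and counit_left: "p \<in> \<Delta> x \<Longrightarrow> lin_ext scale (\<lambda>(a, b). scale (\<epsilon> a) b) p = x"
    and counit_right: "p \<in> \<Delta> x \<Longrightarrow> lin_ext scale (\<lambda>(a, b). scale (\<epsilon> b) a) p = x"
    and Delta_one: "\<Delta> 1 = tensor_of scale scale (bas (1, 1))"
    and Delta_mult: "p \<in> \<Delta> x \<Longrightarrow> q \<in> \<Delta> y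
          \<Longrightarrow> bilin_ext (\<lambda>(a, b) (c, d). (a * c, b * d)) p q \<in> \<Delta> (x * y)"
    and counit_one: "\<epsilon> 1 = 1"
    and counit_mult: "\<epsilon> (x * y) = \<epsilon> x * \<epsilon> y"

locale graded_bialgebra = bialgebra scale \<Delta> \<epsilon>
  for scale :: "'k::field \<Rightarrow> 'h::ring_1 \<Rightarrow> 'h"
    and \<Delta> :: "'h \<Rightarrow> ('k, 'h, 'h) tensor"
    and \<epsilon> :: "'h \<Rightarrow> 'k" +
  fixes H :: "nat \<Rightarrow> 'h set"
  assumes grade_subspace: "subspace (H n)"
    and grade_direct_sum: "\<exists>!f :: nat \<Rightarrow>\<^sub>0 'h. (\<forall>n. Poly_Mapping.lookup f n \<in> H n)
          \<and> x = (\<Sum>n\<in>Poly_Mapping.keys f. Poly_Mapping.lookup f n)"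
    and grade_one: "1 \<in> H 0"
    and grade_mult: "x \<in> H k \<Longrightarrow> y \<in> H l \<Longrightarrow> x * y \<in> H (k + l)"
    and grade_Delta: "x \<in> H n \<Longrightarrow>
          \<exists>p. \<Delta> x = tensor_of scale scale p \<and> Poly_Mapping.keys p \<subseteq> (\<Union>i\<in>{0..n}. H i \<times> H (n - i))"
    and grade_counit: "n \<ge> 1 \<Longrightarrow> x \<in> H n \<Longrightarrow> \<epsilon> x = 0"

locale graded_connected_bialgebra = graded_bialgebra scale \<Delta> \<epsilon> H
  for scale :: "'k::field \<Rightarrow> 'h::ring_1 \<Rightarrow> 'h"
    and \<Delta> :: "'h \<Rightarrow> ('k, 'h, 'h) tensor"
    and \<epsilon> :: "'h \<Rightarrow> 'k"
    and H :: "nat \<Rightarrow> 'h set" +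
  assumes connected: "dim (H 0) = 1"

definition Prim ::
  "('k::field \<Rightarrow> 'h::ring_1 \<Rightarrow> 'h) \<Rightarrow> ('h \<Rightarrow> ('k, 'h, 'h) tensor) \<Rightarrow> 'h set" where
  "Prim scale \<Delta> = {x. \<Delta> x = tensor_of scale scale (bas (x, 1) + bas (1, x))}"

section \<open>Free associative algebras\<close>

text \<open>
  The free unital associative algebra on \<open>X\<close> has the words in \<open>X\<close> as a basis, multiplied by
  concatenation; \<open>lin_ext scale prod_list\<close> is its canonical algebra morphism to the algebra
  containing \<open>X\<close>.
\<close>

definition free_algebra_space :: "'x set \<Rightarrow> ('x list \<Rightarrow>\<^sub>0 'k::field) set" where
  "free_algebra_space X = {p. Poly_Mapping.keys p \<subseteq> lists X}"

definition free_algebra :: "('k::field \<Rightarrow> 'h::ring_1 \<Rightarrow> 'h) \<Rightarrow> bool" where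
  "free_algebra scale \<longleftrightarrow>
    (\<exists>X. bij_betw (lin_ext scale prod_list) (free_algebra_space X) UNIV)"

section \<open>Free Lie algebras\<close>

text \<open>
  The free Lie algebra on \<open>X\<close> is the quotient of the free nonassociative algebra on \<open>X\<close>, which
  has the free magma on \<open>X\<close> as a basis, by the two-sided ideal generated by the elements
  \<open>aa\<close> and \<open>a(bc) + b(ca) + c(ab)\<close>.
\<close>

datatype 'x magma = Gen 'x | Br "'x magma" "'x magma"

abbreviation mag_mult :: "('x magma \<Rightarrow>\<^sub>0 'k::field) \<Rightarrow> ('x magma \<Rightarrow>\<^sub>0 'k) \<Rightarrow> ('x magma \<Rightarrow>\<^sub>0 'k)" where
  "mag_mult \<equiv> bilin_ext Br"

definition free_magma_algebra :: "'x set \<Rightarrow> ('x magma \<Rightarrow>\<^sub>0 'k::field) set" where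
  "free_magma_algebra X = {p. \<forall>t\<in>Poly_Mapping.keys p. set_magma t \<subseteq> X}"

inductive_set lie_ideal :: "'x set \<Rightarrow> ('x magma \<Rightarrow>\<^sub>0 'k::field) set" for X :: "'x set" where
  alternating: "a \<in> free_magma_algebra X \<Longrightarrow> mag_mult a a \<in> lie_ideal X"
| jacobi: "\<lbrakk>a \<in> free_magma_algebra X; b \<in> free_magma_algebra X; c \<in> free_magma_algebra X\<rbrakk> \<Longrightarrow>
    mag_mult a (mag_mult b c) + mag_mult b (mag_mult c a) + mag_mult c (mag_mult a b) \<in> lie_ideal X"
| zero: "0 \<in> lie_ideal X"
| add: "\<lbrakk>p \<in> lie_ideal X; q \<in> lie_ideal X\<rbrakk> \<Longrightarrow> p + q \<in> lie_ideal X"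
| scale: "p \<in> lie_ideal X \<Longrightarrow> fscale c p \<in> lie_ideal X"
| mult_left: "\<lbrakk>a \<in> free_magma_algebra X; p \<in> lie_ideal X\<rbrakk> \<Longrightarrow> mag_mult a p \<in> lie_ideal X"
| mult_right: "\<lbrakk>a \<in> free_magma_algebra X; p \<in> lie_ideal X\<rbrakk> \<Longrightarrow> mag_mult p a \<in> lie_ideal X"

primrec magma_eval :: "('x \<Rightarrow> 'x \<Rightarrow> 'x) \<Rightarrow> 'x magma \<Rightarrow> 'x" where
  "magma_eval br (Gen x) = x"
| "magma_eval br (Br t u) = br (magma_eval br t) (magma_eval br u)"

text \<open>
  \<open>L\<close> with the bracket \<open>br\<close> is free on \<open>X\<close> iff the canonical morphism from the free
  nonassociative algebra maps onto \<open>L\<close> with kernel exactly that ideal, i.e. iff it induces an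
  isomorphism from the free Lie algebra on \<open>X\<close> to \<open>L\<close>.
\<close>

definition free_lie_algebra_on ::
  "('k::field \<Rightarrow> 'v::ab_group_add \<Rightarrow> 'v) \<Rightarrow> ('v \<Rightarrow> 'v \<Rightarrow> 'v) \<Rightarrow> 'v set \<Rightarrow> 'v set \<Rightarrow> bool" where
  "free_lie_algebra_on s br L X \<longleftrightarrow>
     lin_ext s (magma_eval br) ` free_magma_algebra X = L \<and>
     {p \<in> free_magma_algebra X. lin_ext s (magma_eval br) p = 0} = lie_ideal X"

definition free_lie_algebra ::
  "('k::field \<Rightarrow> 'v::ab_group_add \<Rightarrow> 'v) \<Rightarrow> ('v \<Rightarrow> 'v \<Rightarrow> 'v) \<Rightarrow> 'v set \<Rightarrow> bool" where
  "free_lie_algebra s br L \<longleftrightarrow> (\<exists>X. free_lie_algebra_on s br L X)"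

end

theory Submission
  imports Defs "HOL-Library.Multiset"
begin

text \<open>
  Let \<open>X\<close> be a homogeneous basis of a complement of \<open>[\<gg>, \<gg>]\<close> in \<open>\<gg> = Prim H\<close>; it generates \<open>\<gg>\<close> as a Lie
  algebra by induction on the degree. In a relation \<open>\<Sum> h\<^sub>x x = 0\<close> with \<open>h\<^sub>x \<in> H\<close> all \<open>\<epsilon> h\<^sub>x\<close> vanish:
  since the subalgebra \<open>U\<close> generated by \<open>\<gg>\<close> has a complement stable under right multiplication by \<open>\<gg>\<close>, one may
  take \<open>h\<^sub>x \<in> U\<close>, so that \<open>\<Sum> (\<epsilon> h\<^sub>x) x\<close> is a primitive sum of products of at least two primitive elements,
  and the eigenvalues \<open>2 ^ k\<close> of \<open>m \<circ> \<Delta>\<close> put it in \<open>[\<gg>, \<gg>]\<close>. The left ideal \<open>H X\<close> of the free algebra \<open>H\<close>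
  is projective, so by Nakayama's lemma these generators, having no relation with invertible coefficients, are a
  basis of it. Hence the words in \<open>X\<close> are linearly independent, and by the Dynkin--Specht--Wever theorem the Lie
  algebra generated by \<open>X\<close> is free on \<open>X\<close>. Coproducts are handled through their contractions
  \<open>(f \<otimes> id) \<circ> \<Delta>\<close> with linear functionals \<open>f\<close>, which separate tensors.
\<close>

text \<open>The components \<open>H n\<close> may be infinite-dimensional, so the graded dual need
  not be a bialgebra; contracting the left tensor factor with one functional at a time takes the
  place of duality. Nor does freeness of \<open>H\<close> restrict to \<open>U\<close>, since a
  subalgebra of a free algebra need not be free. What passes down is a statement about left ideals,
  because grouping words in \<open>X\<close> by their last letter turns a relation between words
  into one of the form \<open>\<Sum> h\<^sub>x x = 0\<close>. Its coefficients lie in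
  \<open>H\<close>, whereas primitivity controls coefficients in \<open>U\<close> only; the
  complement of \<open>U\<close> bridges this gap. The free generators of \<open>H\<close> are not
  assumed homogeneous, so the splitting of \<open>H X\<close> need not respect degrees, and only the
  degrees of coefficients are counted. Characteristic zero enters twice: to tell \<open>2\<close>
  from \<open>2 ^ k\<close> for \<open>k \<ge> 2\<close>, and to divide by the length of a
  word.\<close>

lemmas linear_imp_module_hom = module_hom_iff_linear[THEN iffD2]


section \<open>Linear extensions\<close>

lemma lin_ext_superset:
  assumes "vector_space s" "finite A" "Poly_Mapping.keys p \<subseteq> A"
  shows "lin_ext s f p = (\<Sum>x\<in>A. s (Poly_Mapping.lookup p x) (f x))"
proof -
  interpret vector_space s by fact
  show ?thesis unfolding lin_ext_def
    by (rule sum.mono_neutral_left) (use assms in \<open>auto simp: in_keys_iff\<close>)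
qed

lemma linear_lin_ext:
  fixes s :: "'k::field \<Rightarrow> 'v::ab_group_add \<Rightarrow> 'v"
  assumes "vector_space s"
  shows "Vector_Spaces.linear fscale s (lin_ext s f)"
proof -
  interpret vector_space s by fact
  interpret F: vector_space "fscale :: 'k \<Rightarrow> ('x \<Rightarrow>\<^sub>0 'k) \<Rightarrow> _" by (rule vector_space_fscale)
  show ?thesis
  proof (unfold_locales, goal_cases)
    case (1 p q)
    let ?A = "Poly_Mapping.keys p \<union> Poly_Mapping.keys q"
    have "Poly_Mapping.keys (p + q) \<subseteq> ?A" by (rule Poly_Mapping.keys_add)
    then show ?case
      by (simp add: lin_ext_superset[OF assms, of ?A] lookup_add scale_left_distrib sum.distrib)
  next
    case (2 c p)
    have "Poly_Mapping.keys (fscale c p) \<subseteq> Poly_Mapping.keys p" by (auto simp: in_keys_iff)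
    then show ?case
      by (simp add: lin_ext_superset[OF assms, of "Poly_Mapping.keys p"] scale_sum_right)
  qed
qed

lemma lin_ext_single [simp]:
  assumes "vector_space s"
  shows "lin_ext s f (Poly_Mapping.single x c) = s c (f x)"
proof -
  interpret vector_space s by fact
  show ?thesis by (simp add: lin_ext_def)
qed

lemmas lin_ext_add = module_hom.add[OF linear_imp_module_hom[OF linear_lin_ext]]
  and lin_ext_diff = module_hom.diff[OF linear_imp_module_hom[OF linear_lin_ext]]
  and lin_ext_fscale = module_hom.scale[OF linear_imp_module_hom[OF linear_lin_ext]]
  and lin_ext_sum = module_hom.sum[OF linear_imp_module_hom[OF linear_lin_ext]]
  and lin_ext_zero = module_hom.zero[OF linear_imp_module_hom[OF linear_lin_ext]]

lemma linearI:
  assumes "vector_space s1" "vector_space s2"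
    and "\<And>x y. f (x + y) = f x + f y" "\<And>c x. f (s1 c x) = s2 c (f x)"
  shows "Vector_Spaces.linear s1 s2 f"
proof -
  interpret a: vector_space s1 by fact
  interpret b: vector_space s2 by fact
  show ?thesis by unfold_locales (use assms(3,4) in auto)
qed

lemma vector_space_field: "vector_space ((*) :: 'k::field \<Rightarrow> 'k \<Rightarrow> 'k)"
  by unfold_locales (auto simp: algebra_simps)

lemma poly_mapping_fscale_sum:
  "(p :: 'x \<Rightarrow>\<^sub>0 'k::field) = (\<Sum>x\<in>Poly_Mapping.keys p. fscale (Poly_Mapping.lookup p x) (bas x))"
proof (rule poly_mapping_eqI)
  fix y
  have "(\<Sum>x\<in>Poly_Mapping.keys p. Poly_Mapping.lookup p x * Poly_Mapping.lookup (bas x :: 'x \<Rightarrow>\<^sub>0 'k) y)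
      = (\<Sum>x\<in>Poly_Mapping.keys p. if x = y then Poly_Mapping.lookup p x else 0)"
    by (rule sum.cong) (auto simp: lookup_single)
  also have "\<dots> = Poly_Mapping.lookup p y" by (simp add: in_keys_iff)
  finally show "Poly_Mapping.lookup p y = Poly_Mapping.lookup
      (\<Sum>x\<in>Poly_Mapping.keys p. fscale (Poly_Mapping.lookup p x) (bas x)) y"
    by (simp add: lookup_sum)
qed

lemma linear_eq_lin_ext:
  assumes "Vector_Spaces.linear fscale s L"
  shows "L p = lin_ext s (\<lambda>x. L (bas x)) p"
proof -
  interpret Vector_Spaces.linear fscale s L by fact
  show ?thesis
    by (subst poly_mapping_fscale_sum) (simp add: sum scale lin_ext_def)
qed

lemma lin_ext_comp:
  assumes "Vector_Spaces.linear s1 s2 g"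
  shows "g (lin_ext s1 f p) = lin_ext s2 (\<lambda>x. g (f x)) p"
proof -
  interpret Vector_Spaces.linear s1 s2 g by fact
  show ?thesis by (simp add: lin_ext_def sum scale)
qed

lemma lin_ext_cong: "(\<And>x. x \<in> Poly_Mapping.keys p \<Longrightarrow> f x = g x) \<Longrightarrow> lin_ext s f p = lin_ext s g p"
  by (simp add: lin_ext_def)

lemma lin_ext_plus:
  assumes "vector_space s"
  shows "lin_ext s (\<lambda>x. f x + g x) p = lin_ext s f p + lin_ext s g p"
proof -
  interpret vector_space s by fact
  show ?thesis by (simp add: lin_ext_def scale_right_distrib sum.distrib)
qed

lemma lin_ext_bilin_ext:
  assumes "vector_space s"
  shows "lin_ext s h (bilin_ext f p q)
    = lin_ext s (\<lambda>x. lin_ext s (\<lambda>y. h (f x y)) q) p"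
proof -
  interpret vector_space s by fact
  show ?thesis
    by (simp add: bilin_ext_def lin_ext_sum[OF assms] lin_ext_single[OF assms])
      (simp add: lin_ext_def scale_sum_right)
qed

lemma keys_bilin_ext:
  "Poly_Mapping.keys (bilin_ext f p q)
    \<subseteq> {f x y | x y. x \<in> Poly_Mapping.keys p \<and> y \<in> Poly_Mapping.keys q}"
proof
  fix z assume "z \<in> Poly_Mapping.keys (bilin_ext f p q)"
  then have "Poly_Mapping.lookup (bilin_ext f p q) z \<noteq> 0" by (simp add: in_keys_iff)
  then have "(\<Sum>x\<in>Poly_Mapping.keys p. \<Sum>y\<in>Poly_Mapping.keys q. Poly_Mapping.lookup
     (Poly_Mapping.single (f x y) (Poly_Mapping.lookup p x * Poly_Mapping.lookup q y)) z) \<noteq> 0"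
    by (simp add: bilin_ext_def lookup_sum)
  then obtain x where x: "x \<in> Poly_Mapping.keys p" "(\<Sum>y\<in>Poly_Mapping.keys q. Poly_Mapping.lookup
     (Poly_Mapping.single (f x y) (Poly_Mapping.lookup p x * Poly_Mapping.lookup q y)) z) \<noteq> 0"
    by (rule sum.not_neutral_contains_not_neutral)
  from x(2) obtain y where "y \<in> Poly_Mapping.keys q" "Poly_Mapping.lookup
     (Poly_Mapping.single (f x y) (Poly_Mapping.lookup p x * Poly_Mapping.lookup q y)) z \<noteq> 0"
    by (rule sum.not_neutral_contains_not_neutral)
  with x(1) show "z \<in> {f x y | x y. x \<in> Poly_Mapping.keys p \<and> y \<in> Poly_Mapping.keys q}"
    by (auto simp: lookup_single when_def split: if_splits)
qed

section \<open>Tensors\<close>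

text \<open>One half of the universal property of the tensor product: a bilinear
  \<open>\<beta>\<close> respects each generating relation, so its extension to formal sums is well
  defined on cosets.\<close>

lemma lin_ext_bilinear_relations:
  fixes s1 :: "'k::field \<Rightarrow> 'v::ab_group_add \<Rightarrow> 'v"
    and s2 :: "'k \<Rightarrow> 'w::ab_group_add \<Rightarrow> 'w"
    and s3 :: "'k \<Rightarrow> 'u::ab_group_add \<Rightarrow> 'u"
  assumes l: "\<And>b. Vector_Spaces.linear s1 s3 (\<lambda>a. \<beta> a b)"
    and r: "\<And>a. Vector_Spaces.linear s2 s3 (\<beta> a)"
    and p: "p \<in> bilinear_relations s1 s2"
  shows "lin_ext s3 (\<lambda>(a, b). \<beta> a b) p = 0"
proof -
  have s3: "vector_space s3" using l unfolding Vector_Spaces.linear_def by blast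
  interpret F: vector_space "fscale :: 'k \<Rightarrow> ('v \<times> 'w \<Rightarrow>\<^sub>0 'k) \<Rightarrow> _" by (rule vector_space_fscale)
  interpret B: vector_space s3 by (rule s3)
  note l' = module_hom.add[OF linear_imp_module_hom[OF l]] module_hom.scale[OF linear_imp_module_hom[OF l]]
    module_hom.add[OF linear_imp_module_hom[OF r]] module_hom.scale[OF linear_imp_module_hom[OF r]]
  note e = lin_ext_add[OF s3] lin_ext_diff[OF s3] lin_ext_fscale[OF s3] lin_ext_single[OF s3]
    lin_ext_zero[OF s3]
  show ?thesis using p unfolding bilinear_relations_def
    by (induction rule: F.span_induct_alt) (auto simp: e l')
qed

lemma subspace_bilinear_relations:
  fixes s1 :: "'k::field \<Rightarrow> 'v::ab_group_add \<Rightarrow> 'v" and s2 :: "'k \<Rightarrow> 'w::ab_group_add \<Rightarrow> 'w"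
  shows "module.subspace fscale (bilinear_relations s1 s2)"
proof -
  interpret F: vector_space "fscale :: 'k \<Rightarrow> ('v \<times> 'w \<Rightarrow>\<^sub>0 'k) \<Rightarrow> _" by (rule vector_space_fscale)
  show ?thesis unfolding bilinear_relations_def by (rule F.subspace_span)
qed

lemma mem_tensor_of [simp]:
  fixes p :: "'v::ab_group_add \<times> 'w::ab_group_add \<Rightarrow>\<^sub>0 'k::field"
  shows "p \<in> tensor_of s1 s2 p"
proof -
  interpret F: vector_space "fscale :: 'k \<Rightarrow> ('v \<times> 'w \<Rightarrow>\<^sub>0 'k) \<Rightarrow> _"
    by (rule vector_space_fscale)
  show ?thesis
    using F.subspace_0[OF subspace_bilinear_relations] by (simp add: tensor_of_def)
qed

lemma tensor_of_eqI:
  fixes p :: "'v::ab_group_add \<times> 'w::ab_group_add \<Rightarrow>\<^sub>0 'k::field"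
  assumes "p - q \<in> bilinear_relations s1 s2"
  shows "tensor_of s1 s2 p = tensor_of s1 s2 q"
proof -
  interpret F: vector_space "fscale :: 'k \<Rightarrow> ('v \<times> 'w \<Rightarrow>\<^sub>0 'k) \<Rightarrow> _"
    by (rule vector_space_fscale)
  note sub = subspace_bilinear_relations[of s1 s2]
  have "r - p \<in> bilinear_relations s1 s2 \<longleftrightarrow> r - q \<in> bilinear_relations s1 s2" for r
    using F.subspace_add[OF sub _ assms, of "r - p"] F.subspace_diff[OF sub _ assms, of "r - q"]
    by auto
  then show ?thesis by (simp add: tensor_of_def)
qed

text \<open>A basis of \<open>S\<close> stays independent after adding \<open>v\<close>, so a linear
  form may be prescribed as \<open>1\<close> at \<open>v\<close> and \<open>0\<close> on that
  basis.\<close>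

lemma (in vector_space) separating_functional:
  assumes S: "subspace S" and v: "v \<notin> S"
  obtains \<phi> where "Vector_Spaces.linear scale (*) \<phi>" "\<And>x. x \<in> S \<Longrightarrow> \<phi> x = 0" "\<phi> v = 1"
proof -
  interpret K: vector_space "(*) :: 'a \<Rightarrow> 'a \<Rightarrow> 'a" by (rule vector_space_field)
  interpret P: vector_space_pair scale "(*) :: 'a \<Rightarrow> 'a \<Rightarrow> 'a" by unfold_locales
  obtain B where B: "B \<subseteq> S" "independent B" "S \<subseteq> span B"
    by (rule maximal_independent_subset)
  have "span B = S" using B S by (metis span_subspace)
  with v B have "independent (insert v B)" by (simp add: independent_insertI)
  then obtain \<phi> where \<phi>: "Vector_Spaces.linear scale (*) \<phi>" "\<And>x. x \<in> insert v B \<Longrightarrow> \<phi> x = (if x = v then 1 else 0)"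
    using P.linear_independent_extend[of "insert v B" "\<lambda>x. if x = v then 1 else 0"] by blast
  interpret \<phi>: Vector_Spaces.linear scale "(*)" \<phi> by fact
  have "\<phi> x = 0" if "x \<in> S" for x
  proof -
    from that B have "x \<in> span B" by blast
    then show ?thesis
      by (induction rule: span_induct_alt)
        (use \<phi>(2) v B(1) in \<open>auto simp: \<phi>.zero \<phi>.add \<phi>.scale\<close>)
  qed
  with \<phi> show ?thesis by (intro that[of \<phi>]) auto
qed

text \<open>
  A functional on formal sums that vanishes on the relations is a bilinear form, hence determined
  by its values at \<open>(c, b)\<close> with \<open>c\<close> in a basis; this reduces the claim to coordinate functionals.
\<close>

lemma bilinear_relations_separation:
  fixes s1 :: "'k::field \<Rightarrow> 'v::ab_group_add \<Rightarrow> 'v" and s2 :: "'k \<Rightarrow> 'w::ab_group_add \<Rightarrow> 'w"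
  assumes "vector_space s1" "vector_space s2"
    and z: "\<And>f. Vector_Spaces.linear s1 (*) f \<Longrightarrow> lin_ext s2 (\<lambda>(a, b). s2 (f a) b) p = 0"
  shows "p \<in> bilinear_relations s1 s2"
proof (rule ccontr)
  assume p: "p \<notin> bilinear_relations s1 s2"
  interpret V: vector_space s1 by fact
  interpret W: vector_space s2 by fact
  interpret K: vector_space "(*) :: 'k \<Rightarrow> 'k \<Rightarrow> 'k" by (rule vector_space_field)
  interpret F: vector_space "fscale :: 'k \<Rightarrow> ('v \<times> 'w \<Rightarrow>\<^sub>0 'k) \<Rightarrow> _" by (rule vector_space_fscale)
  obtain \<phi> where \<phi>: "Vector_Spaces.linear fscale (*) \<phi>"
      "\<And>r. r \<in> bilinear_relations s1 s2 \<Longrightarrow> \<phi> r = 0" "\<phi> p = 1"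
    using F.separating_functional[OF subspace_bilinear_relations p] by blast
  interpret \<phi>: Vector_Spaces.linear fscale "(*)" \<phi> by fact
  define \<beta> where "\<beta> a b = \<phi> (bas (a, b))" for a b
  let ?G = "{bas (a + a', b) - bas (a, b) - bas (a', b) | a a' b. True}
    \<union> {bas (a, b + b') - bas (a, b) - bas (a, b') | a b b'. True}
    \<union> {bas (s1 c a, b) - fscale c (bas (a, b)) | c a b. True}
    \<union> {bas (a, s2 c b) - fscale c (bas (a, b)) | c a b. True}"
  have gen: "?G \<subseteq> bilinear_relations s1 s2"
    unfolding bilinear_relations_def by (rule F.span_superset)
  have "\<beta> (a + a') b = \<beta> a b + \<beta> a' b" for a a' b
  proof -
    have "\<phi> (bas (a + a', b) - bas (a, b) - bas (a', b)) = 0"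
      by (rule \<phi>(2), rule subsetD[OF gen]) blast
    then show ?thesis unfolding \<beta>_def \<phi>.diff by (simp add: algebra_simps)
  qed
  moreover have "\<beta> (s1 c a) b = c * \<beta> a b" for c a b
  proof -
    have "\<phi> (bas (s1 c a, b) - fscale c (bas (a, b))) = 0"
      by (rule \<phi>(2), rule subsetD[OF gen]) blast
    then show ?thesis by (simp add: \<beta>_def \<phi>.diff \<phi>.scale)
  qed
  moreover have "\<beta> a (b + b') = \<beta> a b + \<beta> a b'" for a b b'
  proof -
    have "\<phi> (bas (a, b + b') - bas (a, b) - bas (a, b')) = 0"
      by (rule \<phi>(2), rule subsetD[OF gen]) blast
    then show ?thesis unfolding \<beta>_def \<phi>.diff by (simp add: algebra_simps)
  qed
  moreover have "\<beta> a (s2 c b) = c * \<beta> a b" for c a b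
  proof -
    have "\<phi> (bas (a, s2 c b) - fscale c (bas (a, b))) = 0"
      by (rule \<phi>(2), rule subsetD[OF gen]) blast
    then show ?thesis by (simp add: \<beta>_def \<phi>.diff \<phi>.scale)
  qed
  ultimately have l: "Vector_Spaces.linear s1 (*) (\<lambda>a. \<beta> a b)"
    and r: "Vector_Spaces.linear s2 (*) (\<beta> a)" for a b
    by (auto intro!: linearI V.vector_space_axioms W.vector_space_axioms K.vector_space_axioms)
  obtain C where C: "V.independent C" "V.span C = UNIV"
    by (metis V.independent_empty V.independent_extend_basis V.span_extend_basis)
  \<comment> \<open>Only finitely many basis vectors occur in the first components of
    \<open>p\<close>; one finite index set for all terms allows the sums to be interchanged.\<close>
  define A where "A = (\<Union>k\<in>Poly_Mapping.keys p. {c. V.representation C (fst k) c \<noteq> 0})"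
  have A: "finite A" by (auto simp: A_def V.finite_representation)
  have exp: "\<beta> a b = (\<Sum>c\<in>A. V.representation C a c * \<beta> c b)" if "(a, b) \<in> Poly_Mapping.keys p" for a b
  proof -
    have sub: "{c. V.representation C a c \<noteq> 0} \<subseteq> A" using that by (force simp: A_def)
    have "\<beta> a b = \<beta> (\<Sum>c\<in>{c. V.representation C a c \<noteq> 0}. s1 (V.representation C a c) c) b"
      using V.sum_nonzero_representation_eq[OF C(1), of a] C(2) by simp
    also have "\<dots> = (\<Sum>c\<in>{c. V.representation C a c \<noteq> 0}. V.representation C a c * \<beta> c b)"
      by (simp add: module_hom.sum[OF linear_imp_module_hom[OF l]]
          module_hom.scale[OF linear_imp_module_hom[OF l]])
    also have "\<dots> = (\<Sum>c\<in>A. V.representation C a c * \<beta> c b)"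
      by (rule sum.mono_neutral_left) (use A sub in auto)
    finally show ?thesis .
  qed
  have "\<phi> p = lin_ext (*) (\<lambda>(a, b). \<beta> a b) p"
    by (subst linear_eq_lin_ext[OF \<phi>(1)]) (rule lin_ext_cong, auto simp: \<beta>_def)
  also have "\<dots> = lin_ext (*) (\<lambda>(a, b). \<Sum>c\<in>A. V.representation C a c * \<beta> c b) p"
    by (rule lin_ext_cong) (use exp in auto)
  also have "\<dots> = (\<Sum>c\<in>A. lin_ext (*) (\<lambda>(a, b). V.representation C a c * \<beta> c b) p)"
    unfolding lin_ext_def by (subst sum.swap) (simp add: sum_distrib_left case_prod_unfold)
  \<comment> \<open>For fixed \<open>c\<close> the linear form \<open>\<beta> c\<close> can be
    pulled out; what remains inside is the contraction of \<open>p\<close> with the coordinate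
    functional of \<open>c\<close>, which \<open>z\<close> kills.\<close>
  also have "\<dots> = (\<Sum>c\<in>A. \<beta> c (lin_ext s2 (\<lambda>(a, b). s2 (V.representation C a c) b) p))"
    by (simp add: lin_ext_comp[OF r] case_prod_unfold module_hom.scale[OF linear_imp_module_hom[OF r]])
  also have "\<dots> = (\<Sum>c\<in>A. \<beta> c 0)"
    by (simp add: z[OF V.linear_representation[OF C]])
  also have "\<dots> = 0" by (simp add: module_hom.zero[OF linear_imp_module_hom[OF r]])
  finally show False using \<phi>(3) by simp
qed

section \<open>Contractions of the coproduct\<close>

abbreviation (in vector_space) functional :: "('b \<Rightarrow> 'a) \<Rightarrow> bool" where
  "functional \<equiv> Vector_Spaces.linear scale (*)"

abbreviation (in vector_space) endo :: "('b \<Rightarrow> 'b) \<Rightarrow> bool" where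
  "endo \<equiv> Vector_Spaces.linear scale scale"

lemma (in vector_space) functionalI:
  "(\<And>x y. f (x + y) = f x + f y) \<Longrightarrow> (\<And>c x. f (scale c x) = c * f x) \<Longrightarrow> functional f"
  by (rule linearI[OF vector_space_axioms vector_space_field])

lemma (in vector_space) endoI:
  "(\<And>x y. f (x + y) = f x + f y) \<Longrightarrow> (\<And>c x. f (scale c x) = scale c (f x)) \<Longrightarrow> endo f"
  by (rule linearI[OF vector_space_axioms vector_space_axioms])

lemma linear_plus: "Vector_Spaces.linear s1 s2 f \<Longrightarrow> f (x + y) = f x + f y"
  by (rule module_hom.add[OF linear_imp_module_hom])
lemma linear_minus: "Vector_Spaces.linear s1 s2 f \<Longrightarrow> f (x - y) = f x - f y"
  by (rule module_hom.diff[OF linear_imp_module_hom])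
lemma linear_times: "Vector_Spaces.linear s1 s2 f \<Longrightarrow> f (s1 c x) = s2 c (f x)"
  by (rule module_hom.scale[OF linear_imp_module_hom])
lemma linear_zero: "Vector_Spaces.linear s1 s2 f \<Longrightarrow> f 0 = 0"
  by (rule module_hom.zero[OF linear_imp_module_hom])
lemma linear_setsum: "Vector_Spaces.linear s1 s2 f \<Longrightarrow> f (sum g A) = (\<Sum>x\<in>A. f (g x))"
  by (rule module_hom.sum[OF linear_imp_module_hom])

context bialgebra
begin

lemma endo_mult_left: "endo (\<lambda>x. y * x)"
  by (rule endoI) (auto simp: distrib_left scale_mult_right)

lemma endo_mult_right: "endo (\<lambda>x. x * y)"
  by (rule endoI) (auto simp: distrib_right scale_mult_left)

lemma Delta_representative: "\<exists>p. p \<in> \<Delta> x"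
  using Delta_tensor[of x] mem_tensor_of[where ?s1.0 = scale and ?s2.0 = scale]
  unfolding tensor_space_def by blast

lemma some_Delta: "(SOME p. p \<in> \<Delta> x) \<in> \<Delta> x"
  using Delta_representative by (rule someI_ex)

lemma Delta_eq_tensor_of: "p \<in> \<Delta> x \<Longrightarrow> \<Delta> x = tensor_of scale scale p"
  using Delta_tensor[of x] tensor_of_eqI unfolding tensor_space_def
  by (force simp: tensor_of_def)

lemma lin_ext_Delta_unique:
  assumes "\<And>b. Vector_Spaces.linear scale s3 (\<lambda>a. \<beta> a b)" "\<And>a. Vector_Spaces.linear scale s3 (\<beta> a)"
    and "p \<in> \<Delta> x" "q \<in> \<Delta> x"
  shows "lin_ext s3 (\<lambda>(a, b). \<beta> a b) p = lin_ext s3 (\<lambda>(a, b). \<beta> a b) q"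
proof -
  have s3: "vector_space s3" using assms(1) unfolding Vector_Spaces.linear_def by blast
  have "p - q \<in> bilinear_relations scale scale"
    using Delta_eq_tensor_of[OF assms(4)] assms(3) by (auto simp: tensor_of_def)
  from lin_ext_bilinear_relations[of scale s3 \<beta>, OF assms(1,2) this]
  show ?thesis by (simp add: lin_ext_diff[OF s3])
qed

text \<open>This is \<open>(f \<otimes> id) \<circ> \<Delta>\<close>. For linear \<open>f\<close>
  the chosen representative is immaterial by \<open>lin_ext_Delta_unique\<close>.\<close>

definition contract :: "('h \<Rightarrow> 'k) \<Rightarrow> 'h \<Rightarrow> 'h" where
  "contract f x = lin_ext scale (\<lambda>(a, b). scale (f a) b) (SOME p. p \<in> \<Delta> x)"

text \<open>The convolution square of the identity, known as the second Adams operation.\<close>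

definition adams :: "'h \<Rightarrow> 'h" where
  "adams x = lin_ext scale (\<lambda>(a, b). a * b) (SOME p. p \<in> \<Delta> x)"

lemma contract_eq:
  assumes f: "functional f" and p: "p \<in> \<Delta> x"
  shows "contract f x = lin_ext scale (\<lambda>(a, b). scale (f a) b) p"
  unfolding contract_def
proof (rule lin_ext_Delta_unique)
  show "endo (\<lambda>a. scale (f a) b)" for b
    by (rule endoI) (auto simp: linear_plus[OF f] linear_times[OF f] scale_left_distrib)
  show "endo (scale (f a))" for a by simp
qed (use some_Delta p in auto)

lemma adams_eq:
  assumes p: "p \<in> \<Delta> x"
  shows "adams x = lin_ext scale (\<lambda>(a, b). a * b) p"
  unfolding adams_def
  by (rule lin_ext_Delta_unique) (use some_Delta p endo_mult_left endo_mult_right in auto)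

lemma endo_contract:
  assumes f: "functional f"
  shows "endo (contract f)"
proof (rule endoI)
  fix x y
  obtain p q where "p \<in> \<Delta> x" "q \<in> \<Delta> y" using Delta_representative by blast
  then show "contract f (x + y) = contract f x + contract f y"
    by (simp add: contract_eq[OF f] contract_eq[OF f Delta_add] lin_ext_add[OF vector_space_axioms])
next
  fix c x
  obtain p where "p \<in> \<Delta> x" using Delta_representative by blast
  then show "contract f (scale c x) = scale c (contract f x)"
    by (simp add: contract_eq[OF f] contract_eq[OF f Delta_scale] lin_ext_fscale[OF vector_space_axioms])
qed

lemma endo_adams: "endo adams"
proof (rule endoI)
  fix x y
  obtain p q where "p \<in> \<Delta> x" "q \<in> \<Delta> y" using Delta_representative by blast
  then show "adams (x + y) = adams x + adams y"
    by (simp add: adams_eq adams_eq[OF Delta_add] lin_ext_add[OF vector_space_axioms])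
next
  fix c x
  obtain p where "p \<in> \<Delta> x" using Delta_representative by blast
  then show "adams (scale c x) = scale c (adams x)"
    by (simp add: adams_eq adams_eq[OF Delta_scale] lin_ext_fscale[OF vector_space_axioms])
qed

lemma functional_comp: "functional f \<Longrightarrow> endo g \<Longrightarrow> functional (\<lambda>x. f (g x))"
  by (rule functionalI) (auto simp: linear_plus linear_times)

lemma functional_counit: "functional \<epsilon>"
  by (rule functionalI) (auto simp: counit_add counit_scale)

lemma contract_zero: "contract (\<lambda>_. 0) x = 0"
  by (simp add: contract_def lin_ext_def case_prod_unfold)

lemma contract_one:
  assumes "functional f"
  shows "contract f 1 = scale (f 1) 1"
  using contract_eq[OF assms, of "bas (1, 1)" 1] Delta_one vector_space_axioms by simp

lemma contract_counit: "contract \<epsilon> x = x"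
  using contract_eq[OF functional_counit] counit_left Delta_representative[of x] by fastforce

text \<open>Both sides are \<open>f\<close> applied to
  \<open>(id \<otimes> \<epsilon>) (\<Delta> x)\<close>. A contraction known to be a scalar is
  thereby determined.\<close>

lemma counit_contract:
  assumes f: "functional f"
  shows "\<epsilon> (contract f x) = f x"
proof -
  obtain p where p: "p \<in> \<Delta> x" using Delta_representative by blast
  have "\<epsilon> (contract f x) = lin_ext (*) (\<lambda>z. \<epsilon> (case z of (a, b) \<Rightarrow> scale (f a) b)) p"
    unfolding contract_eq[OF f p] by (rule lin_ext_comp[OF functional_counit])
  also have "\<dots> = lin_ext (*) (\<lambda>z. f (case z of (a, b) \<Rightarrow> scale (\<epsilon> b) a)) p"
    by (rule lin_ext_cong) (auto simp: counit_scale linear_times[OF f])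
  also have "\<dots> = f (lin_ext scale (\<lambda>(a, b). scale (\<epsilon> b) a) p)"
    by (rule lin_ext_comp[OF f, symmetric])
  also have "\<dots> = f x" using counit_right[OF p] by simp
  finally show ?thesis .
qed

section \<open>Primitivity in terms of contractions\<close>

abbreviation "\<gg> \<equiv> Prim scale \<Delta>"

lemma Delta_Prim: "x \<in> \<gg> \<Longrightarrow> bas (x, 1) + bas (1, x) \<in> \<Delta> x"
  by (simp add: Prim_def)

lemma Delta_mult_Prim:
  assumes "x \<in> \<gg>" "p \<in> \<Delta> h"
  shows "bilin_ext (\<lambda>(a, b) (c, d). (a * c, b * d)) p (bas (x, 1) + bas (1, x)) \<in> \<Delta> (h * x)"
  by (rule Delta_mult) (use assms Delta_Prim in auto)

text \<open>In \<open>\<Delta> (h x) = \<Delta> h (x \<otimes> 1 + 1 \<otimes> x)\<close> the factor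
  \<open>x\<close> either multiplies the remaining right factor or is absorbed into the
  functional.\<close>

lemma contract_mult_Prim:
  assumes f: "functional f" and x: "x \<in> \<gg>"
  shows "contract f (h * x) = contract f h * x + contract (\<lambda>a. f (a * x)) h"
proof -
  obtain p where p: "p \<in> \<Delta> h" using Delta_representative by blast
  note V = vector_space_axioms
  have g: "functional (\<lambda>a. f (a * x))" by (rule functional_comp[OF f endo_mult_right])
  have "contract f (h * x) = lin_ext scale (\<lambda>z. (case z of (a, b) \<Rightarrow> scale (f a) b) * x
      + (case z of (a, b) \<Rightarrow> scale (f (a * x)) b)) p"
    unfolding contract_eq[OF f Delta_mult_Prim[OF x p]] lin_ext_bilin_ext[OF V]
    by (rule lin_ext_cong) (auto simp: lin_ext_add[OF V] lin_ext_single[OF V] scale_mult_left)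
  also have "\<dots> = contract f h * x + contract (\<lambda>a. f (a * x)) h"
    unfolding lin_ext_plus[OF V] contract_eq[OF f p] contract_eq[OF g p]
    by (simp add: lin_ext_comp[OF endo_mult_right])
  finally show ?thesis .
qed

text \<open>Contractions separate tensors by \<open>bilinear_relations_separation\<close>, so
  primitivity becomes a family of identities in \<open>H\<close> itself.\<close>

lemma Prim_iff: "x \<in> \<gg> \<longleftrightarrow> (\<forall>f. functional f \<longrightarrow> contract f x = scale (f x) 1 + scale (f 1) x)"
proof
  assume x: "x \<in> \<gg>"
  show "\<forall>f. functional f \<longrightarrow> contract f x = scale (f x) 1 + scale (f 1) x"
    using contract_eq[OF _ Delta_Prim[OF x]]
    by (simp add: lin_ext_add[OF vector_space_axioms] lin_ext_single[OF vector_space_axioms])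
next
  assume *: "\<forall>f. functional f \<longrightarrow> contract f x = scale (f x) 1 + scale (f 1) x"
  obtain p where p: "p \<in> \<Delta> x" using Delta_representative by blast
  have "p - (bas (x, 1) + bas (1, x)) \<in> bilinear_relations scale scale"
    by (rule bilinear_relations_separation)
      (use * p in \<open>auto simp: vector_space_axioms contract_eq lin_ext_diff[OF vector_space_axioms]
         lin_ext_add[OF vector_space_axioms] lin_ext_single[OF vector_space_axioms]\<close>)
  from tensor_of_eqI[OF this] show "x \<in> \<gg>"
    unfolding Prim_def using Delta_eq_tensor_of[OF p] by simp
qed

lemma contract_Prim: "x \<in> \<gg> \<Longrightarrow> functional f \<Longrightarrow> contract f x = scale (f x) 1 + scale (f 1) x"
  using Prim_iff by blast

lemma counit_Prim: "x \<in> \<gg> \<Longrightarrow> \<epsilon> x = 0"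
  using contract_Prim[OF _ functional_counit] contract_counit counit_one by simp

lemma subspace_Prim: "subspace \<gg>"
  unfolding subspace_def
proof (intro conjI ballI allI)
  show "0 \<in> \<gg>" unfolding Prim_iff by (auto simp: linear_zero linear_zero[OF endo_contract])
next
  fix x y assume "x \<in> \<gg>" "y \<in> \<gg>" then show "x + y \<in> \<gg>"
    unfolding Prim_iff
    by (simp add: linear_plus linear_plus[OF endo_contract] scale_left_distrib scale_right_distrib)
next
  fix c x assume "x \<in> \<gg>" then show "scale c x \<in> \<gg>"
    unfolding Prim_iff
    by (simp add: linear_times linear_times[OF endo_contract] scale_right_distrib scale_left_commute)
qed

lemma Prim_bracket:
  assumes x: "x \<in> \<gg>" and y: "y \<in> \<gg>"
  shows "x * y - y * x \<in> \<gg>"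
  unfolding Prim_iff
proof safe
  fix f assume f: "functional f"
  \<comment> \<open>The mixed terms \<open>scale (f x) y + scale (f y) x\<close> are symmetric in
    \<open>x\<close> and \<open>y\<close>, hence cancel in the commutator.\<close>
  have *: "contract f (x * y) = scale (f x) y + scale (f 1) (x * y) + scale (f (x * y)) 1 + scale (f y) x"
    if "x \<in> \<gg>" "y \<in> \<gg>" for x y
  proof -
    have g: "functional (\<lambda>a. f (a * y))" by (rule functional_comp[OF f endo_mult_right])
    show ?thesis using that
      by (simp add: contract_mult_Prim[OF f] contract_Prim f g distrib_right scale_mult_left)
  qed
  show "contract f (x * y - y * x) = scale (f (x * y - y * x)) 1 + scale (f 1) (x * y - y * x)"
    by (simp add: linear_minus[OF endo_contract[OF f]] linear_minus[OF f] *[OF x y] *[OF y x]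
        scale_left_diff_distrib scale_right_diff_distrib)
qed

end

section \<open>The grading\<close>

context graded_bialgebra
begin

definition hcomp :: "nat \<Rightarrow> 'h \<Rightarrow> 'h" where
  "hcomp n x = Poly_Mapping.lookup (THE f :: nat \<Rightarrow>\<^sub>0 'h. (\<forall>n. Poly_Mapping.lookup f n \<in> H n)
          \<and> x = (\<Sum>n\<in>Poly_Mapping.keys f. Poly_Mapping.lookup f n)) n"

lemma hcomp_eqI:
  assumes "\<And>n. Poly_Mapping.lookup f n \<in> H n" "x = (\<Sum>n\<in>Poly_Mapping.keys f. Poly_Mapping.lookup f n)"
  shows "hcomp n x = Poly_Mapping.lookup f n"
proof -
  have "(THE f :: nat \<Rightarrow>\<^sub>0 'h. (\<forall>n. Poly_Mapping.lookup f n \<in> H n)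
          \<and> x = (\<Sum>n\<in>Poly_Mapping.keys f. Poly_Mapping.lookup f n)) = f"
    by (rule the1_equality[OF grade_direct_sum]) (use assms in auto)
  then show ?thesis by (simp add: hcomp_def)
qed

lemma hcomp_decomposition:
  obtains f :: "nat \<Rightarrow>\<^sub>0 'h" where "\<And>n. hcomp n x = Poly_Mapping.lookup f n" "\<And>n. Poly_Mapping.lookup f n \<in> H n"
    "x = (\<Sum>n\<in>Poly_Mapping.keys f. Poly_Mapping.lookup f n)"
  using grade_direct_sum[of x] hcomp_eqI by (metis (no_types, lifting))

lemma hcomp_mem: "hcomp n x \<in> H n"
  by (metis hcomp_decomposition)

lemma sum_hcomp:
  obtains N where "x = (\<Sum>n<N. hcomp n x)"
proof -
  obtain f :: "nat \<Rightarrow>\<^sub>0 'h" where f: "\<And>n. hcomp n x = Poly_Mapping.lookup f n"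
    "x = (\<Sum>n\<in>Poly_Mapping.keys f. Poly_Mapping.lookup f n)"
    by (metis hcomp_decomposition)
  obtain N where N: "Poly_Mapping.keys f \<subseteq> {..<N}"
    using finite_nat_set_iff_bounded[of "Poly_Mapping.keys f"] by auto
  have "x = (\<Sum>n<N. hcomp n x)" unfolding f(1)
    by (subst f(2), rule sum.mono_neutral_left) (use N in \<open>auto simp: in_keys_iff\<close>)
  then show ?thesis by (rule that)
qed

lemma hcomp_homogeneous:
  assumes "x \<in> H m"
  shows "hcomp n x = (if n = m then x else 0)"
proof -
  have "hcomp n x = Poly_Mapping.lookup (Poly_Mapping.single m x) n"
    by (rule hcomp_eqI) (use assms subspace_0[OF grade_subspace] in
        \<open>auto simp: lookup_single when_def\<close>)
  then show ?thesis by (simp add: lookup_single when_def)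
qed

lemma endo_hcomp: "endo (hcomp n)"
proof (rule endoI)
  fix x y
  obtain f g where f: "\<And>n. hcomp n x = Poly_Mapping.lookup f n" "\<And>n. Poly_Mapping.lookup f n \<in> H n"
      "x = (\<Sum>n\<in>Poly_Mapping.keys f. Poly_Mapping.lookup f n)"
    and g: "\<And>n. hcomp n y = Poly_Mapping.lookup g n" "\<And>n. Poly_Mapping.lookup g n \<in> H n"
      "y = (\<Sum>n\<in>Poly_Mapping.keys g. Poly_Mapping.lookup g n)"
    by (metis hcomp_decomposition)
  have "hcomp n (x + y) = Poly_Mapping.lookup (f + g) n"
  proof (rule hcomp_eqI)
    show "Poly_Mapping.lookup (f + g) n \<in> H n" for n
      using f g by (simp add: lookup_add subspace_add[OF grade_subspace])
    show "x + y = (\<Sum>n\<in>Poly_Mapping.keys (f + g). Poly_Mapping.lookup (f + g) n)"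
      using setsum_keys_plus_distrib[of "\<lambda>_ a. a" f g] f(3) g(3) by simp
  qed
  then show "hcomp n (x + y) = hcomp n x + hcomp n y" by (simp only: f(1) g(1) lookup_add)
next
  fix c x
  obtain f where f: "\<And>n. hcomp n x = Poly_Mapping.lookup f n" "\<And>n. Poly_Mapping.lookup f n \<in> H n"
      "x = (\<Sum>n\<in>Poly_Mapping.keys f. Poly_Mapping.lookup f n)"
    by (metis hcomp_decomposition)
  let ?g = "Poly_Mapping.map (scale c) f"
  have g: "Poly_Mapping.lookup ?g n = scale c (Poly_Mapping.lookup f n)" for n
    by (simp add: Poly_Mapping.map.rep_eq when_def)
  have "hcomp n (scale c x) = Poly_Mapping.lookup ?g n"
  proof (rule hcomp_eqI)
    show "Poly_Mapping.lookup ?g n \<in> H n" for n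
      using f by (simp add: g subspace_scale[OF grade_subspace])
    have "(\<Sum>n\<in>Poly_Mapping.keys ?g. Poly_Mapping.lookup ?g n) = (\<Sum>n\<in>Poly_Mapping.keys f. Poly_Mapping.lookup ?g n)"
      by (rule sum.mono_neutral_left) (auto simp: in_keys_iff g)
    then show "scale c x = (\<Sum>n\<in>Poly_Mapping.keys ?g. Poly_Mapping.lookup ?g n)"
      by (subst f(3)) (simp add: g scale_sum_right)
  qed
  then show "hcomp n (scale c x) = scale c (hcomp n x)" by (simp only: f(1) g)
qed

abbreviation homogeneous :: "'h set" where "homogeneous \<equiv> \<Union>n. H n"

lemma hcomp_span_homogeneous:
  assumes "S \<subseteq> homogeneous" "x \<in> span S"
  shows "hcomp n x \<in> span (S \<inter> H n)"
  using assms(2)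
proof (induction rule: span_induct_alt)
  case base
  then show ?case by (simp add: linear_zero[OF endo_hcomp] span_zero)
next
  case (step c x y)
  obtain m where "x \<in> H m" using step assms(1) by auto
  with step have "hcomp n x \<in> span (S \<inter> H n)"
    by (auto simp: hcomp_homogeneous span_zero intro: span_base)
  with step show ?case
    by (simp add: linear_plus[OF endo_hcomp] linear_times[OF endo_hcomp] span_add span_scale)
qed

lemma span_homogeneous: "x \<in> span homogeneous"
proof -
  obtain N where "x = (\<Sum>n<N. hcomp n x)" by (rule sum_hcomp)
  moreover have "(\<Sum>n<N. hcomp n x) \<in> span homogeneous"
    by (intro span_sum span_base) (use hcomp_mem in auto)
  ultimately show ?thesis by simp
qed

end

section \<open>Primitive elements of a graded connected bialgebra\<close>

context graded_connected_bialgebra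
begin

lemma H_zero:
  assumes "y \<in> H 0"
  shows "y = scale (\<epsilon> y) 1"
proof -
  obtain B where B: "B \<subseteq> H 0" "independent B" "H 0 \<subseteq> span B" "card B = 1"
    using basis_exists[of "H 0"] connected by metis
  then obtain b where b: "B = {b}" by (auto simp: card_1_singleton_iff)
  have "1 \<in> span {b}" "y \<in> span {b}" using B b assms grade_one by auto
  then have "\<exists>c. 1 = scale c b" "\<exists>d. y = scale d b"
    unfolding span_singleton image_iff by simp_all
  then obtain c d where c: "1 = scale c b" and d: "y = scale d b" by metis
  have "c \<noteq> 0" using c by auto
  then have "scale (1 / c) (scale c b) = b" by simp
  then have "b = scale (1 / c) 1" by (simp only: c[symmetric])
  then have "y = scale (d / c) 1" unfolding d by (metis scale_scale times_divide_eq_right mult_1_right)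
  moreover from this have "\<epsilon> y = d / c" by (simp add: counit_scale counit_one)
  ultimately show ?thesis by simp
qed

text \<open>Elements of degree \<open>d\<close> of the graded dual; contraction with one lowers
  degrees by exactly \<open>d\<close>.\<close>

definition hfunctional :: "nat \<Rightarrow> ('h \<Rightarrow> 'k) \<Rightarrow> bool" where
  "hfunctional d f \<longleftrightarrow> functional f \<and> (\<forall>m y. y \<in> H m \<longrightarrow> m \<noteq> d \<longrightarrow> f y = 0)"

lemma functional_hcomp: "functional f \<Longrightarrow> hfunctional d (\<lambda>x. f (hcomp d x))"
  unfolding hfunctional_def
  by (auto simp: functional_comp[OF _ endo_hcomp] hcomp_homogeneous linear_zero)

lemma Delta_graded_representative:
  assumes "x \<in> H n"
  obtains p where "p \<in> \<Delta> x" "\<And>a b. (a, b) \<in> Poly_Mapping.keys p \<Longrightarrow> \<exists>i\<le>n. a \<in> H i \<and> b \<in> H (n - i)"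
proof -
  obtain p where "\<Delta> x = tensor_of scale scale p" "Poly_Mapping.keys p \<subseteq> (\<Union>i\<in>{0..n}. H i \<times> H (n - i))"
    using grade_Delta[OF assms] by blast
  then show ?thesis by (intro that[of p]) fastforce+
qed

text \<open>In a graded representative only terms whose left factor has degree \<open>d\<close>
  survive \<open>f\<close>, and their right factor has degree \<open>n - d\<close>. For
  \<open>n < d\<close> there are no such terms.\<close>

lemma contract_grade:
  assumes f: "hfunctional d f" and x: "x \<in> H n"
  shows "d \<le> n \<Longrightarrow> contract f x \<in> H (n - d)" and "n < d \<Longrightarrow> contract f x = 0"
proof -
  obtain p where p: "p \<in> \<Delta> x"
    "\<And>a b. (a, b) \<in> Poly_Mapping.keys p \<Longrightarrow> \<exists>i\<le>n. a \<in> H i \<and> b \<in> H (n - i)"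
    using Delta_graded_representative[OF x] by metis
  have eq: "contract f x = (\<Sum>z\<in>Poly_Mapping.keys p. scale (Poly_Mapping.lookup p z) (scale (f (fst z)) (snd z)))"
    using f p(1) unfolding hfunctional_def by (simp add: contract_eq lin_ext_def case_prod_unfold)
  { assume "d \<le> n"
    show "contract f x \<in> H (n - d)" unfolding eq
    proof (rule subspace_sum[OF grade_subspace], rule subspace_scale[OF grade_subspace])
      fix z assume "z \<in> Poly_Mapping.keys p"
      then obtain i where "fst z \<in> H i" "snd z \<in> H (n - i)" using p(2)[of "fst z" "snd z"] by auto
      then show "scale (f (fst z)) (snd z) \<in> H (n - d)"
        using f subspace_0[OF grade_subspace] subspace_scale[OF grade_subspace]
        by (cases "i = d") (auto simp: hfunctional_def)
    qed }
  { assume "n < d"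
    then have "f (fst z) = 0" if "z \<in> Poly_Mapping.keys p" for z
      using p(2)[of "fst z" "snd z"] that f by (auto simp: hfunctional_def)
    then show "contract f x = 0" unfolding eq by simp }
qed

text \<open>The contraction lies in \<open>H 0\<close>, hence is a scalar, which
  \<open>counit_contract\<close> identifies.\<close>

lemma contract_top:
  assumes "hfunctional n f" "x \<in> H n"
  shows "contract f x = scale (f x) 1"
  using H_zero[of "contract f x"] contract_grade(1)[OF assms] counit_contract[of f x] assms(1)
  by (simp add: hfunctional_def)

text \<open>On an element of degree \<open>n\<close> a functional sees only left factors of degree
  at most \<open>n\<close>, so it may be replaced by a finite sum of its homogeneous parts.\<close>

lemma contract_sum_hcomp:
  assumes f: "functional f" and x: "x \<in> H n"
  shows "contract f x = (\<Sum>m\<le>n. contract (\<lambda>y. f (hcomp m y)) x)"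
proof -
  obtain p where p: "p \<in> \<Delta> x"
    "\<And>a b. (a, b) \<in> Poly_Mapping.keys p \<Longrightarrow> \<exists>i\<le>n. a \<in> H i \<and> b \<in> H (n - i)"
    using Delta_graded_representative[OF x] by metis
  have "f (fst z) = (\<Sum>m\<le>n. f (hcomp m (fst z)))" if "z \<in> Poly_Mapping.keys p" for z
  proof -
    have "\<exists>i\<le>n. fst z \<in> H i \<and> snd z \<in> H (n - i)" by (rule p(2)) (use that in simp)
    then obtain i where i: "i \<le> n" "fst z \<in> H i" by blast
    have "(\<Sum>m\<le>n. f (hcomp m (fst z))) = (\<Sum>m\<le>n. if m = i then f (fst z) else 0)"
      by (rule sum.cong) (use i in \<open>auto simp: hcomp_homogeneous linear_zero[OF f]\<close>)
    then show ?thesis using i by simp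
  qed
  then have "contract f x = (\<Sum>z\<in>Poly_Mapping.keys p. scale (Poly_Mapping.lookup p z)
      (scale (\<Sum>m\<le>n. f (hcomp m (fst z))) (snd z)))"
    using f p(1) by (simp add: contract_eq lin_ext_def case_prod_unfold)
  also have "\<dots> = (\<Sum>m\<le>n. contract (\<lambda>y. f (hcomp m y)) x)"
    using p(1) functional_comp[OF f endo_hcomp]
    by (simp add: contract_eq lin_ext_def case_prod_unfold scale_sum_left scale_sum_right sum_distrib_left)
      (rule sum.swap)
  finally show ?thesis .
qed

lemma span_homogeneous_induct:
  assumes "\<And>n x. x \<in> H n \<Longrightarrow> P x" "P 0" "\<And>x y. P x \<Longrightarrow> P y \<Longrightarrow> P (x + y)"
  shows "P x"
proof -
  have "x \<in> span homogeneous" by (rule span_homogeneous)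
  then show ?thesis
    by (induction rule: span_induct_alt)
      (use assms subspace_scale[OF grade_subspace] in blast)+
qed

lemma hcomp_contract:
  assumes f: "hfunctional d f" and "d \<le> n"
  shows "hcomp (n - d) (contract f x) = contract f (hcomp n x)"
proof (induction x rule: span_homogeneous_induct)
  have ef: "endo (contract f)" using f by (simp add: hfunctional_def endo_contract)
  {
    case (1 m x)
    show ?case
    proof (cases "m < d")
      case True
      then show ?thesis
        using contract_grade(2)[OF f 1] assms(2)
        by (auto simp: hcomp_homogeneous[OF 1] linear_zero[OF endo_hcomp] linear_zero[OF ef])
    next
      case False
      then have "contract f x \<in> H (m - d)" using contract_grade(1)[OF f 1] by simp
      then show ?thesis using False assms(2)
        by (auto simp: hcomp_homogeneous[OF 1] hcomp_homogeneous[of _ "m - d"] linear_zero[OF ef])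
    qed
  next
    case 2
    show ?case by (simp add: linear_zero[OF endo_hcomp] linear_zero[OF ef])
  next
    case (3 x y)
    then show ?case by (simp add: linear_plus[OF endo_hcomp] linear_plus[OF ef])
  }
qed

lemma Prim_H_zero: "x \<in> \<gg> \<Longrightarrow> x \<in> H 0 \<Longrightarrow> x = 0"
  using H_zero[of x] counit_Prim[of x] by simp

lemma counit_hcomp_zero: "\<epsilon> (hcomp 0 x) = \<epsilon> x"
proof (induction x rule: span_homogeneous_induct)
  case (1 n x)
  then show ?case using grade_counit[of n x]
    by (auto simp: hcomp_homogeneous[OF 1] linear_zero[OF functional_counit])
qed (simp_all add: linear_zero[OF endo_hcomp] linear_plus[OF endo_hcomp] counit_add)

lemma hcomp_zero: "hcomp 0 x = scale (\<epsilon> x) 1"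
  using H_zero[OF hcomp_mem[of 0 x]] by (simp add: counit_hcomp_zero)

lemma Prim_hcomp:
  assumes x: "x \<in> \<gg>"
  shows "hcomp n x \<in> \<gg>"
proof (cases "n = 0")
  case True
  then show ?thesis using subspace_0[OF subspace_Prim] by (simp add: hcomp_zero counit_Prim[OF x])
next
  case n: False
  show ?thesis unfolding Prim_iff
  proof safe
    fix f assume f: "functional f"
    \<comment> \<open>Primitivity is tested on the homogeneous parts of \<open>f\<close>. Here
      \<open>hcomp (n - m) 1\<close> vanishes unless \<open>m = n\<close>, and
      \<open>f (hcomp m 1)\<close> vanishes unless \<open>m = 0\<close>, so the degrees in between
      contribute nothing.\<close>
    have *: "contract (\<lambda>y. f (hcomp m y)) (hcomp n x)
        = (if m = n then scale (f (hcomp n x)) 1 else 0) + (if m = 0 then scale (f 1) (hcomp n x) else 0)"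
      if m: "m \<le> n" for m
    proof -
      let ?f = "\<lambda>y. f (hcomp m y)"
      have hf: "hfunctional m ?f" "functional ?f"
        using functional_hcomp[OF f] functional_comp[OF f endo_hcomp] by auto
      have "contract ?f (hcomp n x) = hcomp (n - m) (scale (?f x) 1 + scale (?f 1) x)"
        unfolding hcomp_contract[OF hf(1) m, symmetric] contract_Prim[OF x hf(2)] ..
      also have "\<dots> = scale (?f x) (hcomp (n - m) 1) + scale (?f 1) (hcomp (n - m) x)"
        by (simp add: linear_plus[OF endo_hcomp] linear_times[OF endo_hcomp])
      also have "\<dots> = (if m = n then scale (f (hcomp n x)) 1 else 0) + (if m = 0 then scale (f 1) (hcomp n x) else 0)"
        using n m by (auto simp: hcomp_homogeneous[OF grade_one] linear_zero[OF f])
      finally show ?thesis .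
    qed
    have "contract f (hcomp n x) = (\<Sum>m\<le>n. contract (\<lambda>y. f (hcomp m y)) (hcomp n x))"
      by (rule contract_sum_hcomp[OF f hcomp_mem])
    also have "\<dots> = (\<Sum>m\<le>n. (if m = n then scale (f (hcomp n x)) 1 else 0)
        + (if m = 0 then scale (f 1) (hcomp n x) else 0))"
      by (rule sum.cong) (use * in auto)
    also have "\<dots> = scale (f (hcomp n x)) 1 + scale (f 1) (hcomp n x)"
      by (simp add: sum.distrib)
    finally show "contract f (hcomp n x) = scale (f (hcomp n x)) 1 + scale (f 1) (hcomp n x)" .
  qed
qed

lemma Prim_subset_span: "\<gg> \<subseteq> span (\<gg> \<inter> homogeneous)"
proof
  fix x assume x: "x \<in> \<gg>"
  obtain N where "x = (\<Sum>n<N. hcomp n x)" by (rule sum_hcomp)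
  moreover have "(\<Sum>n<N. hcomp n x) \<in> span (\<gg> \<inter> homogeneous)"
    by (intro span_sum span_base) (use hcomp_mem Prim_hcomp[OF x] in auto)
  ultimately show "x \<in> span (\<gg> \<inter> homogeneous)" by simp
qed

subsection \<open>Minimal generators\<close>

definition brackets :: "'h set" where
  "brackets = span {x * y - y * x | x y. x \<in> \<gg> \<and> y \<in> \<gg>}"

lemma subspace_brackets: "subspace brackets"
  unfolding brackets_def by (rule subspace_span)

lemma bracket_mem: "x \<in> \<gg> \<Longrightarrow> y \<in> \<gg> \<Longrightarrow> x * y - y * x \<in> brackets"
  unfolding brackets_def by (rule span_base) auto

lemma brackets_subset_Prim: "brackets \<subseteq> \<gg>"
  unfolding brackets_def
  by (rule span_minimal) (auto simp: Prim_bracket subspace_Prim)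

text \<open>Bilinearity reduces to brackets of homogeneous primitive elements. The derived algebra
  is thereby graded, as the choice of a homogeneous complement requires.\<close>

lemma brackets_homogeneous:
  "brackets = span {x * y - y * x | x y i j. x \<in> \<gg> \<inter> H i \<and> y \<in> \<gg> \<inter> H j}" (is "_ = span ?S")
proof
  have 1: "x * y - y * x \<in> span ?S" if x: "x \<in> \<gg> \<inter> H i" and y: "y \<in> span (\<gg> \<inter> homogeneous)" for i x y
    using y
  proof (induction rule: span_induct_alt)
    case base
    then show ?case by (simp add: span_zero)
  next
    case (step c y z)
    have "x * (scale c y + z) - (scale c y + z) * x = scale c (x * y - y * x) + (x * z - z * x)"
      by (simp add: algebra_simps scale_mult_left scale_mult_right scale_right_diff_distrib)
    moreover have "x * y - y * x \<in> span ?S" by (rule span_base) (use x step(1) in blast)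
    ultimately show ?case using step by (simp add: span_add span_scale)
  qed
  have 2: "x * y - y * x \<in> span ?S" if x: "x \<in> span (\<gg> \<inter> homogeneous)" and y: "y \<in> span (\<gg> \<inter> homogeneous)" for x y
    using x
  proof (induction rule: span_induct_alt)
    case base
    then show ?case by (simp add: span_zero)
  next
    case (step c x z)
    have "(scale c x + z) * y - y * (scale c x + z) = scale c (x * y - y * x) + (z * y - y * z)"
      by (simp add: algebra_simps scale_mult_left scale_mult_right scale_right_diff_distrib)
    moreover have "x * y - y * x \<in> span ?S" using 1 y step(1) by blast
    ultimately show ?case using step by (simp add: span_add span_scale)
  qed
  show "brackets \<subseteq> span ?S"
    unfolding brackets_def
    by (rule span_minimal) (use 2 Prim_subset_span subspace_span in auto)
  show "span ?S \<subseteq> brackets"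
    by (rule span_minimal) (auto simp: subspace_brackets intro: bracket_mem)
qed

text \<open>The classes of \<open>X\<close> form a basis of \<open>\<gg> / [\<gg>, \<gg>]\<close>:
  the second clause says that they span, the third that they are independent.\<close>

definition minimal_generators :: "'h set \<Rightarrow> bool" where
  "minimal_generators X \<longleftrightarrow> X \<subseteq> \<gg> \<inter> homogeneous \<and> (\<forall>x\<in>\<gg>. \<exists>y\<in>span X. x - y \<in> brackets) \<and>
     (\<forall>A c. finite A \<longrightarrow> A \<subseteq> X \<longrightarrow> (\<Sum>x\<in>A. scale (c x) x) \<in> brackets \<longrightarrow> (\<forall>x\<in>A. c x = 0))"

lemma minimal_generators_exist: "\<exists>X. minimal_generators X"
proof -
  obtain S where S: "S \<subseteq> brackets \<inter> homogeneous" "independent S" "brackets \<inter> homogeneous \<subseteq> span S"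
    by (rule maximal_independent_subset)
  have "S \<subseteq> \<gg> \<inter> homogeneous" using S brackets_subset_Prim by auto
  then obtain C where C: "S \<subseteq> C" "C \<subseteq> \<gg> \<inter> homogeneous" "independent C" "\<gg> \<inter> homogeneous \<subseteq> span C"
    using maximal_independent_subset_extend[OF _ S(2)] by metis
  have "{x * y - y * x | x y i j. x \<in> \<gg> \<inter> H i \<and> y \<in> \<gg> \<inter> H j} \<subseteq> brackets \<inter> homogeneous"
  proof safe
    fix x y i j assume *: "x \<in> \<gg>" "x \<in> H i" "y \<in> \<gg>" "y \<in> H j"
    then show "x * y - y * x \<in> brackets" by (simp add: bracket_mem)
    have "x * y - y * x \<in> H (i + j)"
      using * grade_mult[of x i y j] grade_mult[of y j x i]
      by (auto simp: add.commute intro: subspace_diff[OF grade_subspace])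
    then show "x * y - y * x \<in> homogeneous" by blast
  qed
  then have "span {x * y - y * x | x y i j. x \<in> \<gg> \<inter> H i \<and> y \<in> \<gg> \<inter> H j} \<subseteq> span S"
    by (rule span_minimal[OF subset_trans[OF _ S(3)] subspace_span])
  then have "brackets \<subseteq> span S" unfolding brackets_homogeneous[symmetric] .
  moreover have "span S \<subseteq> brackets"
    by (rule span_minimal) (use S subspace_brackets in auto)
  ultimately have bS: "brackets = span S" by auto
  have "minimal_generators (C - S)" unfolding minimal_generators_def
  proof (intro conjI ballI allI impI)
    show "C - S \<subseteq> \<gg> \<inter> homogeneous" using C by auto
    fix x assume "x \<in> \<gg>"
    then have "x \<in> span C" using Prim_subset_span span_minimal[OF C(4)] by auto
    then have "x \<in> span ((C - S) \<union> S)" using C(1) by (simp add: Un_absorb2)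
    then obtain y z where "y \<in> span (C - S)" "z \<in> span S" "x = y + z"
      unfolding span_Un by blast
    then show "\<exists>y\<in>span (C - S). x - y \<in> brackets" using bS by auto
  next
    fix A c x assume A: "finite A" "A \<subseteq> C - S" "(\<Sum>x\<in>A. scale (c x) x) \<in> brackets" and x: "x \<in> A"
    from A(3) obtain T r where T: "finite T" "T \<subseteq> S" "(\<Sum>x\<in>A. scale (c x) x) = (\<Sum>x\<in>T. scale (r x) x)"
      unfolding bS span_explicit by auto
    have AT: "A \<inter> T = {}" using A T by auto
    \<comment> \<open>A combination of \<open>A\<close> lying in \<open>brackets\<close> is also a
      combination of \<open>T \<subseteq> S\<close>. Taking \<open>c\<close> on \<open>A\<close> and
      \<open>- r\<close> on the disjoint set \<open>T\<close> makes this one relation in the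
      independent set \<open>C\<close>.\<close>
    have "(\<Sum>x\<in>A \<union> T. scale (if x \<in> A then c x else - r x) x)
        = (\<Sum>x\<in>A. scale (if x \<in> A then c x else - r x) x) + (\<Sum>x\<in>T. scale (if x \<in> A then c x else - r x) x)"
      by (rule sum.union_disjoint[OF A(1) T(1) AT])
    also have "(\<Sum>x\<in>T. scale (if x \<in> A then c x else - r x) x) = (\<Sum>x\<in>T. - scale (r x) x)"
      by (rule sum.cong) (use AT in auto)
    finally have "(\<Sum>x\<in>A \<union> T. scale (if x \<in> A then c x else - r x) x) = 0"
      using T(3) by (simp add: sum_negf)
    from independentD[OF C(3) _ _ this, of x] show "c x = 0" using A T C x by auto
  qed
  then show ?thesis by blast
qed

lemma minimal_generators_generate:
  assumes X: "minimal_generators X" and L: "subspace L" "X \<subseteq> L"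
    and br: "\<And>x y. x \<in> L \<Longrightarrow> y \<in> L \<Longrightarrow> x * y - y * x \<in> L"
  shows "\<gg> \<subseteq> L"
proof -
  have "\<gg> \<inter> H n \<subseteq> L" for n
  proof (induction n rule: less_induct)
    case (less n)
    show ?case
    proof safe
      fix x assume x: "x \<in> \<gg>" "x \<in> H n"
      obtain a b where a: "a \<in> span X" and b: "b \<in> brackets" and ab: "x = a + b"
        using X x unfolding minimal_generators_def by (metis add.commute diff_add_cancel)
      have "hcomp n a \<in> span (X \<inter> H n)"
        by (rule hcomp_span_homogeneous[OF _ a]) (use X in \<open>auto simp: minimal_generators_def\<close>)
      then have 1: "hcomp n a \<in> L" using span_minimal[OF _ L(1), of "X \<inter> H n"] L(2) by auto
      have 2: "hcomp n b \<in> L"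
        using b unfolding brackets_homogeneous
      proof (induction rule: span_induct_alt)
        case base
        then show ?case by (simp add: linear_zero[OF endo_hcomp] subspace_0[OF L(1)])
      next
        case (step c u w)
        then obtain y z i j where u: "u = y * z - z * y" "y \<in> \<gg>" "y \<in> H i" "z \<in> \<gg>" "z \<in> H j" by blast
        have "u \<in> H (i + j)" unfolding u(1)
          using u grade_mult[of y i z j] grade_mult[of z j y i]
          by (auto simp: add.commute intro: subspace_diff[OF grade_subspace])
        then have hu: "hcomp n u = (if n = i + j then u else 0)" by (simp add: hcomp_homogeneous)
        have "hcomp n u \<in> L"
        \<comment> \<open>Primitive elements of degree 0 vanish, so in a nonzero bracket of degree
          \<open>n\<close> both entries have degree below \<open>n\<close> and the induction
          hypothesis applies.\<close>
        proof (cases "n = i + j \<and> i \<noteq> 0 \<and> j \<noteq> 0")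
          case True
          then have "y \<in> L" "z \<in> L" using less[of i] less[of j] u by auto
          then show ?thesis using br hu u(1) True by simp
        next
          case False
          moreover have "i = 0 \<or> j = 0 \<Longrightarrow> u = 0" using u Prim_H_zero[of y] Prim_H_zero[of z] by auto
          ultimately show ?thesis using hu subspace_0[OF L(1)] by auto
        qed
        then show ?case using step(2)
          by (simp add: linear_plus[OF endo_hcomp] linear_times[OF endo_hcomp]
              subspace_add[OF L(1)] subspace_scale[OF L(1)])
      qed
      have "x = hcomp n x" using x(2) by (simp add: hcomp_homogeneous)
      also have "\<dots> = hcomp n a + hcomp n b" by (simp add: ab linear_plus[OF endo_hcomp])
      finally show "x \<in> L" using 1 2 subspace_add[OF L(1)] by simp
    qed
  qed
  then have "span (\<gg> \<inter> homogeneous) \<subseteq> L" by (intro span_minimal L(1)) auto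
  then show ?thesis using Prim_subset_span by auto
qed

end

section \<open>The subalgebra generated by the primitive elements\<close>

context graded_connected_bialgebra
begin

definition prim_algebra :: "'h set" where
  "prim_algebra = span (prod_list ` lists \<gg>)"

lemma subspace_prim_algebra: "subspace prim_algebra"
  unfolding prim_algebra_def by (rule subspace_span)

lemma prod_list_prim_algebra: "w \<in> lists \<gg> \<Longrightarrow> prod_list w \<in> prim_algebra"
  unfolding prim_algebra_def by (intro span_base) auto

lemma one_prim_algebra: "1 \<in> prim_algebra"
  using prod_list_prim_algebra[of "[]"] by simp

lemma linear_image_span:
  assumes "endo f" "\<And>x. x \<in> S \<Longrightarrow> f x \<in> T" "subspace T" "x \<in> span S"
  shows "f x \<in> T"
  using assms(4)
  by (induction rule: span_induct_alt)
    (auto simp: linear_zero[OF assms(1)] linear_plus[OF assms(1)] linear_times[OF assms(1)] assms(2)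
      intro!: subspace_0[OF assms(3)] subspace_add[OF assms(3)] subspace_scale[OF assms(3)])

lemma prim_algebra_mult_Prim:
  assumes x: "x \<in> \<gg>" and u: "u \<in> prim_algebra"
  shows "u * x \<in> prim_algebra"
proof (rule linear_image_span[OF endo_mult_right _ subspace_prim_algebra])
  show "u \<in> span (prod_list ` lists \<gg>)" using u by (simp add: prim_algebra_def)
  fix v assume "v \<in> prod_list ` lists \<gg>"
  then obtain w where "w \<in> lists \<gg>" "v = prod_list w" by blast
  then show "v * x \<in> prim_algebra" using prod_list_prim_algebra[of "w @ [x]"] x by simp
qed

text \<open>As \<open>f\<close> kills the left ideal \<open>H \<gg>\<close>, the second term of
  \<open>contract_mult_Prim\<close> disappears for each letter: the contraction is right linear over
  \<open>prim_algebra\<close>.\<close>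

lemma contract_mult_prim_algebra:
  assumes f: "functional f" and v: "\<And>h x. x \<in> \<gg> \<Longrightarrow> f (h * x) = 0" and u: "u \<in> prim_algebra"
  shows "contract f (h * u) = contract f h * u"
proof -
  have w: "contract f (h * prod_list w) = contract f h * prod_list w" if "w \<in> lists \<gg>" for w
    using that
  proof (induction w rule: rev_induct)
    case (snoc x w)
    then have "contract f ((h * prod_list w) * x) = contract f h * prod_list w * x"
      by (subst contract_mult_Prim[OF f]) (simp_all add: v contract_zero)
    then show ?case by (simp add: mult.assoc)
  qed simp
  from u show ?thesis unfolding prim_algebra_def
  proof (induction rule: span_induct_alt)
    case (step c u u')
    then obtain l where l: "l \<in> lists \<gg>" "u = prod_list l" by blast
    show ?case
      by (simp add: distrib_left scale_mult_right linear_plus[OF endo_contract[OF f]]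
          linear_times[OF endo_contract[OF f]] step(2) l(2) w[OF l(1)])
  qed (simp add: linear_zero[OF endo_contract[OF f]])
qed

text \<open>
  Milnor and Moore's theorem that \<open>H\<close> is free as a module over \<open>prim_algebra\<close>, in the form needed:
  \<open>prim_algebra\<close> has a complement \<open>M\<close> stable under right multiplication by primitive elements.
  With \<open>B\<close> a homogeneous basis of a complement of \<open>H \<gg> + \<bbbK> 1\<close>, take \<open>M = B prim_algebra\<close>;
  contracting with the coordinate functional of the element of \<open>B\<close> of highest degree in a relation
  isolates its coefficient.
\<close>

lemma prim_algebra_complement:
  obtains M where "subspace M" "\<And>m. m \<in> M \<Longrightarrow> \<epsilon> m = 0" "\<And>m x. m \<in> M \<Longrightarrow> x \<in> \<gg> \<Longrightarrow> m * x \<in> M"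
    "prim_algebra \<inter> M = {0}" "\<And>h. \<exists>u\<in>prim_algebra. h - u \<in> M"
proof -
  \<comment> \<open>The left ideal \<open>H \<gg>\<close>, presented by homogeneous products so that
    it is visibly graded.\<close>
  define J where "J = span {h * x | h x i j. h \<in> H i \<and> x \<in> \<gg> \<inter> H j}"
  have J: "h * x \<in> J" if x: "x \<in> \<gg>" for h x
  proof -
    have 2: "h * x \<in> J" if h: "h \<in> H i" for h i
    proof -
      have "x \<in> span (\<gg> \<inter> homogeneous)" using x Prim_subset_span by auto
      then show ?thesis
      proof (rule linear_image_span[OF endo_mult_left, rotated 2])
        show "subspace J" unfolding J_def by (rule subspace_span)
        fix y assume "y \<in> \<gg> \<inter> homogeneous"
        then show "h * y \<in> J" unfolding J_def by (intro span_base) (use h in auto)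
      qed
    qed
    show ?thesis
    proof (rule linear_image_span[OF endo_mult_right _ _ span_homogeneous])
      show "subspace J" unfolding J_def by (rule subspace_span)
    qed (use 2 in auto)
  qed
  have J\<epsilon>: "\<epsilon> y = 0" if "y \<in> J" for y
    using that unfolding J_def
    by (induction rule: span_induct_alt)
      (auto simp: linear_zero[OF functional_counit] counit_add counit_scale counit_mult counit_Prim)
  obtain S where S: "S \<subseteq> J \<inter> homogeneous" "independent S" "J \<inter> homogeneous \<subseteq> span S"
    by (rule maximal_independent_subset)
  have "span S \<subseteq> J" unfolding J_def by (rule span_minimal) (use S in \<open>auto simp: J_def\<close>)
  moreover have "{h * x | h x i j. h \<in> H i \<and> x \<in> \<gg> \<inter> H j} \<subseteq> J \<inter> homogeneous"
    using grade_mult J by blast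
  then have "span {h * x | h x i j. h \<in> H i \<and> x \<in> \<gg> \<inter> H j} \<subseteq> span S"
    by (rule span_minimal[OF subset_trans[OF _ S(3)] subspace_span])
  then have "J \<subseteq> span S" unfolding J_def[symmetric] .
  ultimately have JS: "J = span S" by auto
  \<comment> \<open>The counit vanishes on \<open>J\<close> but not at \<open>1\<close>, so
    \<open>1\<close> can be added to a basis of \<open>J\<close>; \<open>B\<close> will be the rest
    of a homogeneous basis of \<open>H\<close>.\<close>
  have one: "1 \<notin> span S" using J\<epsilon>[of 1] counit_one JS by auto
  then have "independent (insert 1 S)" using S(2) by (simp add: independent_insertI)
  then obtain C where C: "insert 1 S \<subseteq> C" "C \<subseteq> homogeneous" "independent C" "homogeneous \<subseteq> span C"
    using maximal_independent_subset_extend[of "insert 1 S" homogeneous] S(1) grade_one by blast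
  have C': "span C = UNIV" using span_minimal[OF C(4) subspace_span] span_homogeneous by auto
  define B where "B = C - insert 1 S"
  have "\<exists>n. b \<in> H n" if "b \<in> B" for b using that C(2) by (auto simp: B_def)
  then obtain dg where dg: "\<And>b. b \<in> B \<Longrightarrow> b \<in> H (dg b)" by metis
  define coord where "coord b y = representation C y b" for b y
  have fc: "functional (coord b)" for b
    unfolding coord_def by (rule linear_representation[OF C(3) C'])
  have coord: "coord b c = (if c = b then 1 else 0)" if "c \<in> C" for b c
    unfolding coord_def using representation_basis[OF C(3) that] by simp
  have dgpos: "dg b \<noteq> 0" if b: "b \<in> B" for b
  proof
    assume "dg b = 0"
    then have "b = scale (\<epsilon> b) 1" using H_zero dg[OF b] by simp
    then have "coord b b = \<epsilon> b * coord b 1" using linear_times[OF fc, of b "\<epsilon> b" 1] by simp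
    then show False using b C(1) coord[of b b] coord[of 1 b] by (auto simp: B_def split: if_splits)
  qed
  have coordH: "hfunctional (dg b) (coord b)" if b: "b \<in> B" for b
    unfolding hfunctional_def
  proof (intro conjI allI impI fc)
    fix m y assume y: "y \<in> H m" and m: "m \<noteq> dg b"
    have "b \<notin> H m"
    proof
      assume "b \<in> H m"
      with dg[OF b] m have "b = 0" using hcomp_homogeneous[of b "dg b" m] hcomp_homogeneous[of b m m] by simp
      then show False using b C(3) dependent_zero by (auto simp: B_def)
    qed
    have "y \<in> span C" using C' by simp
    from hcomp_span_homogeneous[OF C(2) this, of m] have "y \<in> span (C \<inter> H m)"
      using y by (simp add: hcomp_homogeneous)
    then show "coord b y = 0"
      by (induction rule: span_induct_alt)
        (use \<open>b \<notin> H m\<close> coord in \<open>auto simp: linear_zero[OF fc] linear_plus[OF fc] linear_times[OF fc]\<close>)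
  qed
  have coordS: "coord b c = 0" if "b \<in> B" "c \<in> S" for b c
    using coord[of c b] that C(1) by (auto simp: B_def)
  have coordJ: "coord b y = 0" if b: "b \<in> B" and y: "y \<in> J" for b y
    using y unfolding JS
    by (induction rule: span_induct_alt)
      (use coordS[OF b] in \<open>auto simp: linear_zero[OF fc] linear_plus[OF fc] linear_times[OF fc]\<close>)
  have coord1: "coord b 1 = 0" if "b \<in> B" for b
    using coord[of 1 b] that C(1) by (auto simp: B_def)
  have con: "contract (coord b) (h * u) = contract (coord b) h * u" if "b \<in> B" "u \<in> prim_algebra" for b h u
    by (rule contract_mult_prim_algebra[OF fc _ that(2)]) (use coordJ[OF that(1)] J in auto)
  \<comment> \<open>The coordinate of \<open>b\<close> kills any \<open>b'\<close> of lower degree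
    and turns one of equal degree into the scalar \<open>coord b b'\<close>. Nothing is claimed for
    higher degrees, which is why \<open>inter\<close> removes an element of highest degree.\<close>
  have conB: "contract (coord b) b' = (if b' = b then 1 else 0)" if "b \<in> B" "b' \<in> B" "dg b' \<le> dg b" for b b'
  proof (cases "dg b' = dg b")
    case True
    then have "contract (coord b) b' = scale (coord b b') 1"
      using contract_top[OF coordH[OF that(1)], of b'] dg[OF that(2)] by simp
    then show ?thesis using coord[of b' b] that(2) by (simp add: B_def)
  next
    case False
    then show ?thesis
      using contract_grade(2)[OF coordH[OF that(1)] dg[OF that(2)]] that(3) by auto
  qed
  define M where "M = span {b * u | b u. b \<in> B \<and> u \<in> prim_algebra}"
  have form: "\<exists>A v. finite A \<and> A \<subseteq> B \<and> (\<forall>b. v b \<in> prim_algebra) \<and> m = (\<Sum>b\<in>A. b * v b)" if "m \<in> M" for m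
    using that unfolding M_def
  proof (induction rule: span_induct_alt)
    case base
    show ?case by (rule exI[of _ "{}"], rule exI[of _ "\<lambda>_. 0"]) (simp add: subspace_0[OF subspace_prim_algebra])
  next
    case (step c x m)
    then obtain b u A v where b: "x = b * u" "b \<in> B" "u \<in> prim_algebra"
      and A: "finite A" "A \<subseteq> B" "\<And>b. v b \<in> prim_algebra" "m = (\<Sum>b\<in>A. b * v b)" by blast
    define v' where "v' z = (if z = b then scale c u else 0) + (if z \<in> A then v z else 0)" for z
    have "(\<Sum>z\<in>insert b A. z * (if z = b then scale c u else 0)) = (\<Sum>z\<in>insert b A. if z = b then b * scale c u else 0)"
      by (rule sum.cong) auto
    also have "\<dots> = b * scale c u" using A(1) by simp
    finally have 1: "(\<Sum>z\<in>insert b A. z * (if z = b then scale c u else 0)) = scale c x"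
      by (simp add: b(1) scale_mult_right)
    have "(\<Sum>z\<in>insert b A. z * (if z \<in> A then v z else 0)) = (\<Sum>z\<in>A. z * (if z \<in> A then v z else 0))"
      by (rule sum.mono_neutral_right) (use A(1) in auto)
    also have "\<dots> = m" unfolding A(4) by (rule sum.cong) auto
    finally have "scale c x + m = (\<Sum>z\<in>insert b A. z * v' z)"
      using 1 by (simp only: v'_def distrib_left sum.distrib)
    moreover have "v' z \<in> prim_algebra" for z
      unfolding v'_def using A(3) b(3) subspace_prim_algebra
      by (auto intro!: subspace_add subspace_scale subspace_0)
    ultimately show ?case using A b by (intro exI[of _ "insert b A"] exI[of _ v']) auto
  qed
  have inter: "(\<Sum>b\<in>A. b * v b) = 0"
    if "finite A" "A \<subseteq> B" "\<forall>b. v b \<in> prim_algebra" "(\<Sum>b\<in>A. b * v b) \<in> prim_algebra" for A v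
    using that
  proof (induction "card A" arbitrary: A)
    case (Suc n A)
    then have "A \<noteq> {}" by auto
    have "Max (dg ` A) \<in> dg ` A" using \<open>finite A\<close> \<open>A \<noteq> {}\<close> by simp
    then obtain b where b: "b \<in> A" "dg b = Max (dg ` A)" by auto
    have mx: "dg b' \<le> dg b" if "b' \<in> A" for b' using that b \<open>finite A\<close> by simp
    have bB: "b \<in> B" using b Suc by auto
    let ?m = "\<Sum>b\<in>A. b * v b"
    have "contract (coord b) ?m = (\<Sum>b'\<in>A. contract (coord b) (b' * v b'))"
      by (rule linear_setsum[OF endo_contract[OF fc]])
    also have "\<dots> = (\<Sum>b'\<in>A. if b' = b then v b else 0)"
    proof (rule sum.cong)
      fix b' assume "b' \<in> A"
      then have "b' \<in> B" using Suc by auto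
      then show "contract (coord b) (b' * v b') = (if b' = b then v b else 0)"
        using Suc conB[OF bB \<open>b' \<in> B\<close> mx[OF \<open>b' \<in> A\<close>]] by (simp add: con[OF bB])
    qed simp
    also have "\<dots> = v b" using b Suc by simp
    \<comment> \<open>The same sum, read as \<open>1\<close> times an element of
      \<open>prim_algebra\<close>, contracts to \<open>coord b 1 = 0\<close> times itself. Comparing
      the two evaluations gives \<open>v b = 0\<close>.\<close>
    finally have "v b = contract (coord b) (1 * ?m)" by simp
    also have "\<dots> = 0"
      using Suc(6) by (simp only: con[OF bB] contract_one[OF fc] coord1[OF bB]) simp
    finally have vb: "v b = 0" .
    then have eq: "?m = (\<Sum>b\<in>A - {b}. b * v b)"
      using b \<open>finite A\<close> by (simp add: sum.remove)
    show ?case unfolding eq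
      by (rule Suc(1)) (use Suc b eq in auto)
  qed simp
  have subM: "subspace M" unfolding M_def by (rule subspace_span)
  have B\<epsilon>: "\<epsilon> b = 0" if "b \<in> B" for b
    using grade_counit[OF _ dg[OF that]] dgpos[OF that] by simp
  have M\<epsilon>: "\<epsilon> m = 0" if "m \<in> M" for m
    using that unfolding M_def
    by (induction rule: span_induct_alt)
      (auto simp: linear_zero[OF functional_counit] counit_add counit_scale counit_mult B\<epsilon>)
  have Mg: "m * x \<in> M" if "m \<in> M" "x \<in> \<gg>" for m x
  proof (rule linear_image_span[OF endo_mult_right _ subM])
    show "m \<in> span {b * u | b u. b \<in> B \<and> u \<in> prim_algebra}" using that by (simp add: M_def)
    fix y assume "y \<in> {b * u | b u. b \<in> B \<and> u \<in> prim_algebra}"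
    then obtain b u where "y = b * u" "b \<in> B" "u \<in> prim_algebra" by blast
    then show "y * x \<in> M" unfolding M_def
      by (intro span_base) (use prim_algebra_mult_Prim[OF that(2)] in \<open>force simp: mult.assoc\<close>)
  qed
  define T where "T = span (prim_algebra \<union> M)"
  have subT: "subspace T" unfolding T_def by (rule subspace_span)
  have Tg: "t * x \<in> T" if "t \<in> T" "x \<in> \<gg>" for t x
  proof (rule linear_image_span[OF endo_mult_right _ subT])
    show "t \<in> span (prim_algebra \<union> M)" using that by (simp add: T_def)
    fix y assume "y \<in> prim_algebra \<union> M"
    then show "y * x \<in> T" unfolding T_def
      by (intro span_base) (use prim_algebra_mult_Prim Mg that(2) in auto)
  qed
  \<comment> \<open>A basis vector of degree \<open>n\<close> is \<open>1\<close>, or in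
    \<open>B\<close>, or in \<open>J\<close>. In the last case projecting to degree \<open>n\<close>
    leaves products \<open>h x\<close> whose primitive factor has positive degree or which vanish,
    so \<open>h\<close> is covered by induction.\<close>
  have HT: "H n \<subseteq> T" for n
  proof (induction n rule: less_induct)
    case (less n)
    have "C \<inter> H n \<subseteq> T"
    proof
      fix c assume c: "c \<in> C \<inter> H n"
      consider "c = 1" | "c \<in> B" | "c \<in> S" using c by (auto simp: B_def)
      then show "c \<in> T"
      proof cases
        case 1
        then show ?thesis using one_prim_algebra by (auto simp: T_def intro: span_base)
      next
        case 2
        then have "c * 1 \<in> M" unfolding M_def using one_prim_algebra by (intro span_base) blast
        then show ?thesis by (auto simp: T_def intro: span_base)
      next
        case 3
        then have "c \<in> J" using S by auto
        have "hcomp n c \<in> T"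
        proof (rule linear_image_span[OF endo_hcomp _ subT])
          show "c \<in> span {h * x | h x i j. h \<in> H i \<and> x \<in> \<gg> \<inter> H j}" using \<open>c \<in> J\<close> by (simp add: J_def)
          fix y assume "y \<in> {h * x | h x i j. h \<in> H i \<and> x \<in> \<gg> \<inter> H j}"
          then obtain h x i j where y: "y = h * x" "h \<in> H i" "x \<in> \<gg>" "x \<in> H j" by blast
          have hy: "hcomp n y = (if n = i + j then y else 0)"
            using grade_mult[OF y(2,4)] by (simp add: y(1) hcomp_homogeneous)
          show "hcomp n y \<in> T"
          proof (cases "n = i + j \<and> j \<noteq> 0")
            case True
            then have "h \<in> T" using less[of i] y by auto
            then show ?thesis using hy True Tg y by simp
          next
            case False
            moreover have "j = 0 \<Longrightarrow> y = 0" using y Prim_H_zero[of x] by auto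
            ultimately show ?thesis using hy subspace_0[OF subT] by auto
          qed
        qed
        then show ?thesis using c hcomp_homogeneous[of c n n] by simp
      qed
    qed
    then have "span (C \<inter> H n) \<subseteq> T" by (rule span_minimal[OF _ subT])
    moreover have "y \<in> span (C \<inter> H n)" if "y \<in> H n" for y
      using hcomp_span_homogeneous[OF C(2), of y n] C' that hcomp_homogeneous[of y n n] by simp
    ultimately show ?case by blast
  qed
  have T: "h \<in> T" for h
    using span_minimal[OF _ subT, of homogeneous] HT span_homogeneous by blast
  have "\<exists>u\<in>prim_algebra. h - u \<in> M" for h
  proof -
    have "h \<in> {x + y | x y. x \<in> prim_algebra \<and> y \<in> M}"
      using T[of h] subspace_prim_algebra subM unfolding T_def span_Un
      by (simp add: span_eq_iff[THEN iffD2])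
    then show ?thesis by force
  qed
  moreover have "prim_algebra \<inter> M = {0}"
    using form inter subspace_0[OF subM] subspace_0[OF subspace_prim_algebra] by blast
  ultimately show ?thesis using subM M\<epsilon> Mg that by blast
qed

end

section \<open>Primitive elements and decomposable elements\<close>

text \<open>All ways to distribute the letters of a word over two words, keeping their order: the
  terms of the unshuffle coproduct, with multiplicity.\<close>

primrec splits :: "'a list \<Rightarrow> ('a list \<times> 'a list) list" where
  "splits [] = [([], [])]"
| "splits (x # w) = map (\<lambda>(u, v). (x # u, v)) (splits w) @ map (\<lambda>(u, v). (u, x # v)) (splits w)"

lemma length_splits: "length (splits w) = 2 ^ length w"
  by (induction w) auto

lemma mset_splits: "(u, v) \<in> set (splits w) \<Longrightarrow> mset u + mset v = mset w"
  by (induction w arbitrary: u v) auto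

lemma bilin_ext_eq_lin_ext:
  fixes p :: "'x \<Rightarrow>\<^sub>0 'k::field" and q :: "'y \<Rightarrow>\<^sub>0 'k" and f :: "'x \<Rightarrow> 'y \<Rightarrow> 'z"
  shows "bilin_ext f p q = lin_ext fscale (\<lambda>x. lin_ext fscale (\<lambda>y. bas (f x y)) q) p"
proof -
  have s: "fscale c (Poly_Mapping.single z d) = Poly_Mapping.single z (c * d)" for c d :: 'k and z :: 'z
    by (rule poly_mapping_eqI) (simp add: lookup_single when_def)
  interpret F: vector_space "fscale :: 'k \<Rightarrow> ('z \<Rightarrow>\<^sub>0 'k) \<Rightarrow> _" by (rule vector_space_fscale)
  show ?thesis by (simp add: bilin_ext_def lin_ext_def F.scale_sum_right s)
qed

lemma bilin_ext_add_left: "bilin_ext f (p + p') q = bilin_ext f p q + bilin_ext f p' q"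
  by (simp add: bilin_ext_eq_lin_ext lin_ext_add[OF vector_space_fscale])

lemma bilin_ext_bas_left: "bilin_ext f (bas x) q = lin_ext fscale (\<lambda>y. bas (f x y)) q"
  by (rule poly_mapping_eqI) (simp add: bilin_ext_eq_lin_ext lin_ext_single[OF vector_space_fscale])

context bialgebra
begin

text \<open>\<open>\<Delta>\<close> is multiplicative, and each factor
  \<open>x \<otimes> 1 + 1 \<otimes> x\<close> sends its letter to the left or to the right.\<close>

lemma Delta_prod_list_Prim:
  assumes "w \<in> lists \<gg>"
  shows "(\<Sum>(u, v)\<leftarrow>splits w. bas (prod_list u, prod_list v)) \<in> \<Delta> (prod_list w)"
  using assms
proof (induction w)
  case Nil
  then show ?case using Delta_one by simp
next
  case (Cons x w)
  let ?f = "\<lambda>(a, b) (c, d). (a * c :: 'h, b * d :: 'h)"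
  have V: "vector_space (fscale :: 'k \<Rightarrow> ('h \<times> 'h \<Rightarrow>\<^sub>0 'k) \<Rightarrow> _)" by (rule vector_space_fscale)
  interpret F: vector_space "fscale :: 'k \<Rightarrow> ('h \<times> 'h \<Rightarrow>\<^sub>0 'k) \<Rightarrow> _" by (rule V)
  have *: "lin_ext fscale g (\<Sum>(u, v)\<leftarrow>l. bas (prod_list u, prod_list v))
      = (\<Sum>(u, v)\<leftarrow>l. g (prod_list u, prod_list v))" for g :: "'h \<times> 'h \<Rightarrow> ('h \<times> 'h \<Rightarrow>\<^sub>0 'k)" and l
    by (induction l) (auto simp: lin_ext_zero[OF V] lin_ext_add[OF V] lin_ext_single[OF V])
  have "bilin_ext ?f (bas (x, 1) + bas (1, x)) (\<Sum>(u, v)\<leftarrow>splits w. bas (prod_list u, prod_list v))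
      \<in> \<Delta> (x * prod_list w)"
    by (rule Delta_mult[OF Delta_Prim]) (use Cons in auto)
  also have "bilin_ext ?f (bas (x, 1) + bas (1, x) :: 'h \<times> 'h \<Rightarrow>\<^sub>0 'k) (\<Sum>(u, v)\<leftarrow>splits w. bas (prod_list u, prod_list v))
      = (\<Sum>(u, v)\<leftarrow>splits (x # w). bas (prod_list u, prod_list v))"
    unfolding bilin_ext_add_left bilin_ext_bas_left *
    by (simp add: o_def case_prod_unfold)
  finally show ?case by simp
qed

lemma adams_prod_list_Prim:
  assumes "w \<in> lists \<gg>"
  shows "adams (prod_list w) = (\<Sum>(u, v)\<leftarrow>splits w. prod_list (u @ v))"
proof -
  have "lin_ext scale g (\<Sum>(u, v)\<leftarrow>l. bas (prod_list u, prod_list v))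
      = (\<Sum>(u, v)\<leftarrow>l. g (prod_list u, prod_list v))" for g :: "'h \<times> 'h \<Rightarrow> 'h" and l
    by (induction l) (auto simp: lin_ext_zero lin_ext_add lin_ext_single vector_space_axioms)
  then show ?thesis
    by (simp add: adams_eq[OF Delta_prod_list_Prim[OF assms]] case_prod_unfold)
qed

lemma adams_Prim: "x \<in> \<gg> \<Longrightarrow> adams x = x + x"
  using adams_prod_list_Prim[of "[x]"] by simp

end

context graded_connected_bialgebra
begin

text \<open>A filtration by the number of factors. It contains \<open>brackets\<close> at every
  level because exchanging the letters of a two-letter word leaves a bracket, which is no word of
  length at least 2; levels 0 and 1 are exactly \<open>brackets\<close>.\<close>

definition decomposable :: "nat \<Rightarrow> 'h set" where
  "decomposable k = span (brackets \<union> prod_list ` {w \<in> lists \<gg>. 2 \<le> length w \<and> length w \<le> k})"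

lemma subspace_decomposable: "subspace (decomposable k)"
  unfolding decomposable_def by (rule subspace_span)

lemma decomposable_mono: "k \<le> l \<Longrightarrow> decomposable k \<subseteq> decomposable l"
  unfolding decomposable_def by (rule span_mono) auto

lemma brackets_decomposable: "brackets \<subseteq> decomposable k"
  unfolding decomposable_def by (auto intro: span_base)

lemma prod_list_decomposable:
  "w \<in> lists \<gg> \<Longrightarrow> 2 \<le> length w \<Longrightarrow> length w \<le> k \<Longrightarrow> prod_list w \<in> decomposable k"
  unfolding decomposable_def by (rule span_base) auto

lemma decomposable_le_one:
  assumes "k \<le> 1"
  shows "decomposable k = brackets"
proof -
  have "{w \<in> lists \<gg>. 2 \<le> length w \<and> length w \<le> k} = {}" using assms by auto
  then show ?thesis
    unfolding decomposable_def by (simp only: image_empty Un_empty_right span_eq_iff subspace_brackets)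
qed

lemma Prim_mult_decomposable:
  assumes x: "x \<in> \<gg>" and m: "m \<in> decomposable n" and n: "n \<ge> 1"
  shows "x * m \<in> decomposable (Suc n)"
proof (rule linear_image_span[OF endo_mult_left _ subspace_decomposable])
  show "m \<in> span (brackets \<union> prod_list ` {w \<in> lists \<gg>. 2 \<le> length w \<and> length w \<le> n})"
    using m by (simp add: decomposable_def)
  fix y assume "y \<in> brackets \<union> prod_list ` {w \<in> lists \<gg>. 2 \<le> length w \<and> length w \<le> n}"
  then consider "y \<in> brackets" | w where "w \<in> lists \<gg>" "2 \<le> length w" "length w \<le> n" "y = prod_list w"
    by auto
  then show "x * y \<in> decomposable (Suc n)"
  proof cases
    case 1
    then show ?thesis
      using prod_list_decomposable[of "[x, y]" "Suc n"] x n brackets_subset_Prim by auto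
  next
    case 2
    then show ?thesis using prod_list_decomposable[of "x # w" "Suc n"] x by auto
  qed
qed

text \<open>Each exchange of \<open>x\<close> with a neighbour \<open>y\<close> costs a word in
  which both are replaced by the single primitive letter \<open>x * y - y * x\<close>, so the error
  has one letter fewer.\<close>

lemma prod_list_move_decomposable:
  assumes "x \<in> \<gg>" "u \<in> lists \<gg>" "v \<in> lists \<gg>"
  shows "prod_list (x # u @ v) - prod_list (u @ x # v) \<in> decomposable (length u + length v)"
  using assms(2)
proof (induction u)
  case Nil
  then show ?case by (simp add: subspace_0[OF subspace_decomposable])
next
  case (Cons y u)
  have xy: "x * y - y * x \<in> brackets" using bracket_mem assms Cons by auto
  let ?n = "length u + length v"
  have eq: "prod_list (x # (y # u) @ v) - prod_list ((y # u) @ x # v)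
      = prod_list ((x * y - y * x) # u @ v) + y * (prod_list (x # u @ v) - prod_list (u @ x # v))"
    by (simp add: algebra_simps)
  show ?case
  proof (cases "?n = 0")
    case True
    then show ?thesis unfolding eq using xy brackets_decomposable by auto
  next
    case False
    have "prod_list ((x * y - y * x) # u @ v) \<in> decomposable (Suc ?n)"
      by (rule prod_list_decomposable) (use False xy brackets_subset_Prim assms Cons in \<open>auto simp: Suc_le_eq\<close>)
    moreover have "y * (prod_list (x # u @ v) - prod_list (u @ x # v)) \<in> decomposable (Suc ?n)"
      by (rule Prim_mult_decomposable) (use False Cons in \<open>auto simp: Suc_le_eq\<close>)
    ultimately show ?thesis unfolding eq using subspace_add[OF subspace_decomposable] by simp
  qed
qed

text \<open>The first letter of \<open>w\<close> is located in \<open>w'\<close> and moved to the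
  front at the cost of shorter words; the tails are then compared by induction.\<close>

lemma prod_list_mset_decomposable:
  assumes "w \<in> lists \<gg>" "mset w = mset w'"
  shows "prod_list w - prod_list w' \<in> decomposable (length w - 1)"
  using assms
proof (induction w arbitrary: w' rule: list.induct)
  case Nil
  then show ?case by (simp add: subspace_0[OF subspace_decomposable])
next
  case (Cons x t)
  have "x \<in> set w'" using Cons.prems(2) by (metis list.set_intros(1) set_mset_mset)
  then obtain u v where w': "w' = u @ x # v" by (meson split_list)
  then have t: "mset t = mset (u @ v)" using Cons.prems(2) by simp
  have "set w' = set (x # t)" using Cons.prems(2) by (metis set_mset_mset)
  then have uv: "u \<in> lists \<gg>" "v \<in> lists \<gg>" using Cons(2) w' by auto
  have len: "length t = length u + length v" using t by (metis length_append size_mset)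
  have 1: "prod_list (x # u @ v) - prod_list (u @ x # v) \<in> decomposable (length t)"
    unfolding len by (rule prod_list_move_decomposable) (use Cons uv in auto)
  have 2: "x * (prod_list t - prod_list (u @ v)) \<in> decomposable (length t)"
  \<comment> \<open>For a tail of at most one letter the truncated \<open>length t - 1\<close> is 0,
    outside the range of \<open>Prim_mult_decomposable\<close>; but then the two tails
    coincide.\<close>
  proof (cases "length t \<le> 1")
    case True
    then have "t = u @ v" using t
      by (cases t; cases "u @ v") (auto simp: len)
    then show ?thesis by (simp add: subspace_0[OF subspace_decomposable])
  next
    case False
    then have "Suc (length t - 1) = length t" "length t - 1 \<ge> 1" by auto
    then show ?thesis
      using Prim_mult_decomposable[OF _ Cons(1)[OF _ t], of x] Cons(2) by simp
  qed
  have "prod_list (x # t) - prod_list w'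
      = x * (prod_list t - prod_list (u @ v)) + (prod_list (x # u @ v) - prod_list (u @ x # v))"
    by (simp add: w' algebra_simps)
  then show ?case using subspace_add[OF subspace_decomposable 2 1] by simp
qed

text \<open>All \<open>2 ^ length w\<close> summands of \<open>adams_prod_list_Prim\<close> are
  rearrangements of \<open>w\<close>.\<close>

lemma adams_prod_list_decomposable:
  assumes w: "w \<in> lists \<gg>"
  shows "adams (prod_list w) - scale (2 ^ length w) (prod_list w) \<in> decomposable (length w - 1)"
proof -
  have 1: "(\<Sum>z\<leftarrow>l. prod_list (fst z @ snd z)) - scale (of_nat (length l)) (prod_list w) \<in> decomposable (length w - 1)"
    if "\<forall>(u, v)\<in>set l. mset (u @ v) = mset w" for l :: "('h list \<times> 'h list) list"
    using that
  proof (induction l)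
    case Nil
    then show ?case by (simp add: subspace_0[OF subspace_decomposable])
  next
    case (Cons z l)
    have "mset w = mset (fst z @ snd z)" using Cons by (auto simp: case_prod_unfold)
    from prod_list_mset_decomposable[OF w this]
    have "prod_list (fst z @ snd z) - prod_list w \<in> decomposable (length w - 1)"
      using subspace_neg[OF subspace_decomposable] by (metis minus_diff_eq)
    from subspace_add[OF subspace_decomposable this Cons(1)] Cons(2)
    show ?case by (simp add: scale_left_distrib algebra_simps)
  qed
  show ?thesis
    using 1[of "splits w"] mset_splits[of _ _ w]
    by (simp add: adams_prod_list_Prim[OF w] length_splits case_prod_unfold)
qed

end

section \<open>Decomposable primitive elements in characteristic zero\<close>

locale graded_connected_bialgebra_char_0 = graded_connected_bialgebra scale \<Delta> \<epsilon> H
  for scale :: "'k::field_char_0 \<Rightarrow> 'h::ring_1 \<Rightarrow> 'h"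
    and \<Delta> :: "'h \<Rightarrow> ('k, 'h, 'h) tensor"
    and \<epsilon> :: "'h \<Rightarrow> 'k"
    and H :: "nat \<Rightarrow> 'h set"
begin

text \<open>
  \<open>adams\<close> acts on \<open>decomposable k / decomposable (k - 1)\<close> by \<open>2 ^ k\<close> and on \<open>\<gg>\<close> by \<open>2\<close>.
\<close>

lemma Prim_decomposable: "x \<in> \<gg> \<Longrightarrow> x \<in> decomposable k \<Longrightarrow> x \<in> brackets"
proof (induction k)
  case 0
  then show ?case by (simp add: decomposable_le_one)
next
  case (Suc k)
  show ?case
  proof (cases "k = 0")
    case True
    then show ?thesis using Suc by (simp add: decomposable_le_one)
  next
    case k: False
    \<comment> \<open>Subtracting the eigenvalue of the top layer pushes
      \<open>decomposable (Suc k)\<close> into \<open>decomposable k\<close>, while on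
      \<open>x\<close> itself \<open>?f\<close> is multiplication by the invertible scalar
      \<open>2 - 2 ^ Suc k\<close>.\<close>
    let ?f = "\<lambda>m. adams m - scale (2 ^ Suc k) m"
    have f: "endo ?f"
      by (rule endoI) (auto simp: linear_plus[OF endo_adams] linear_times[OF endo_adams]
          scale_right_distrib scale_right_diff_distrib mult.commute)
    have "?f x \<in> decomposable k"
    proof (rule linear_image_span[OF f _ subspace_decomposable])
      show "x \<in> span (brackets \<union> prod_list ` {w \<in> lists \<gg>. 2 \<le> length w \<and> length w \<le> Suc k})"
        using Suc by (simp add: decomposable_def)
      fix y assume "y \<in> brackets \<union> prod_list ` {w \<in> lists \<gg>. 2 \<le> length w \<and> length w \<le> Suc k}"
      then consider "y \<in> brackets"
        | w where "w \<in> lists \<gg>" "2 \<le> length w" "length w \<le> k" "y = prod_list w"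
        | w where "w \<in> lists \<gg>" "length w = Suc k" "y = prod_list w"
        by (auto simp: le_Suc_eq)
      then show "?f y \<in> decomposable k"
      proof cases
        case 1
        then have "y \<in> decomposable k" "adams y = y + y"
          using brackets_decomposable brackets_subset_Prim adams_Prim by auto
        then show ?thesis
          using subspace_add subspace_diff subspace_scale subspace_decomposable by simp
      next
        case 2
        have y: "y \<in> decomposable k" using 2 prod_list_decomposable by simp
        have "adams y - scale (2 ^ length w) y \<in> decomposable (length w - 1)"
          unfolding 2(4) by (rule adams_prod_list_decomposable[OF 2(1)])
        then have "adams y - scale (2 ^ length w) y \<in> decomposable k"
          using decomposable_mono[of "length w - 1" k] 2(3) by (meson diff_le_self le_trans subsetD)
        then have "(adams y - scale (2 ^ length w) y) + (scale (2 ^ length w) y - scale (2 ^ Suc k) y)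
            \<in> decomposable k"
          by (rule subspace_add[OF subspace_decomposable])
            (intro subspace_diff[OF subspace_decomposable] subspace_scale[OF subspace_decomposable] y)
        then show ?thesis by (simp only: diff_add_eq_diff_diff_swap add_diff_eq diff_add_cancel)
      next
        case 3
        then show ?thesis using adams_prod_list_decomposable[OF 3(1)] by simp
      qed
    qed
    then have mem: "scale (2 - 2 ^ Suc k) x \<in> decomposable k"
      using adams_Prim[OF Suc(2)] by (simp add: scale_left_diff_distrib scale_left_distrib[of 1 1 x, simplified])
    have nz: "(2 - 2 ^ Suc k :: 'k) \<noteq> 0"
    proof
      assume "(2 - 2 ^ Suc k :: 'k) = 0"
      then have "of_nat (2 ^ Suc k) = (of_nat 2 :: 'k)" by simp
      then have "(2::nat) ^ Suc k = 2" unfolding of_nat_eq_iff .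
      then show False using k by simp
    qed
    have "x \<in> decomposable k"
      using subspace_scale[OF subspace_decomposable mem, of "inverse (2 - 2 ^ Suc k)"]
      by (simp only: scale_scale left_inverse[OF nz] scale_one)
    then show ?thesis using Suc by simp
  qed
qed

lemma Prim_span_products:
  assumes "x \<in> \<gg>" "x \<in> span (prod_list ` {w \<in> lists \<gg>. 2 \<le> length w})"
  shows "x \<in> brackets"
proof -
  have "\<exists>k. x \<in> decomposable k"
    using assms(2)
  proof (induction rule: span_induct_alt)
    case base
    then show ?case using subspace_0[OF subspace_decomposable] by blast
  next
    case (step c y z)
    then obtain w k where "w \<in> lists \<gg>" "2 \<le> length w" "y = prod_list w" "z \<in> decomposable k" by auto
    then have "y \<in> decomposable (max k (length w))" "z \<in> decomposable (max k (length w))"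
      using prod_list_decomposable[of w "max k (length w)"] decomposable_mono[of k "max k (length w)"] by auto
    then show ?case
      using subspace_add[OF subspace_decomposable] subspace_scale[OF subspace_decomposable] by blast
  qed
  then show ?thesis using Prim_decomposable assms(1) by blast
qed

lemma minimal_generators_relation:
  assumes X: "minimal_generators X" and A: "finite A" "A \<subseteq> X"
    and rel: "(\<Sum>x\<in>A. h x * x) = 0" and x: "x \<in> A"
  shows "\<epsilon> (h x) = 0"
proof -
  obtain M where M: "subspace M" "\<And>m. m \<in> M \<Longrightarrow> \<epsilon> m = 0" "\<And>m x. m \<in> M \<Longrightarrow> x \<in> \<gg> \<Longrightarrow> m * x \<in> M"
    "prim_algebra \<inter> M = {0}" "\<And>h. \<exists>u\<in>prim_algebra. h - u \<in> M"
    using prim_algebra_complement by metis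
  \<comment> \<open>Both \<open>prim_algebra\<close> and \<open>M\<close> are stable under right
    multiplication by primitive elements and they meet in 0, so the relation already holds for the
    \<open>prim_algebra\<close> components of the coefficients.\<close>
  have "\<forall>x. \<exists>u. u \<in> prim_algebra \<and> h x - u \<in> M" using M(5) by blast
  then obtain u where u: "\<And>x. u x \<in> prim_algebra" "\<And>x. h x - u x \<in> M" by metis
  have Ag: "x \<in> \<gg>" if "x \<in> A" for x using X A that by (auto simp: minimal_generators_def)
  have "(\<Sum>x\<in>A. u x * x) \<in> prim_algebra"
    by (intro subspace_sum[OF subspace_prim_algebra] prim_algebra_mult_Prim u Ag)
  moreover have "(\<Sum>x\<in>A. (h x - u x) * x) \<in> M"
    by (intro subspace_sum[OF M(1)] M(3) u Ag)
  then have "- (\<Sum>x\<in>A. (h x - u x) * x) \<in> M" by (rule subspace_neg[OF M(1)])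
  then have "(\<Sum>x\<in>A. u x * x) \<in> M"
    using rel by (simp add: left_diff_distrib sum_subtractf)
  ultimately have u0: "(\<Sum>x\<in>A. u x * x) = 0" using M(4) by auto
  let ?P = "span (prod_list ` {w \<in> lists \<gg>. 2 \<le> length w})"
  \<comment> \<open>Without its constant term, \<open>v\<close> is a combination of nonempty words,
    so multiplying by \<open>y\<close> gives words of at least two letters.\<close>
  have P: "(v - scale (\<epsilon> v) 1) * y \<in> ?P" if "v \<in> prim_algebra" "y \<in> \<gg>" for v y
  proof (rule linear_image_span[where f = "\<lambda>v. (v - scale (\<epsilon> v) 1) * y", OF _ _ subspace_span])
    show "endo (\<lambda>v. (v - scale (\<epsilon> v) 1) * y)"
      by (rule endoI) (auto simp: counit_add counit_scale scale_left_distrib algebra_simps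
          scale_mult_left scale_right_diff_distrib)
    show "v \<in> span (prod_list ` lists \<gg>)" using that by (simp add: prim_algebra_def)
    fix z assume "z \<in> prod_list ` lists \<gg>"
    then obtain w where w: "w \<in> lists \<gg>" "z = prod_list w" by blast
    show "(z - scale (\<epsilon> z) 1) * y \<in> ?P"
    proof (cases w)
      case Nil
      then show ?thesis using w by (simp add: counit_one span_zero)
    next
      case (Cons a l)
      then have "\<epsilon> z = 0" using w by (simp add: counit_mult counit_Prim)
      then have "(z - scale (\<epsilon> z) 1) * y = prod_list (w @ [y])" using w by simp
      moreover have "w @ [y] \<in> {w \<in> lists \<gg>. 2 \<le> length w}" using w that Cons by auto
      ultimately show ?thesis by (simp only:) (rule span_base, erule imageI)
    qed
  qed
  have "- (\<Sum>x\<in>A. (u x - scale (\<epsilon> (u x)) 1) * x) \<in> ?P"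
    by (intro span_neg span_sum P u Ag)
  then have "(\<Sum>x\<in>A. scale (\<epsilon> (u x)) x) \<in> ?P"
    using u0 by (simp add: left_diff_distrib sum_subtractf scale_mult_left)
  moreover have "(\<Sum>x\<in>A. scale (\<epsilon> (u x)) x) \<in> \<gg>"
    by (intro subspace_sum[OF subspace_Prim] subspace_scale[OF subspace_Prim] Ag)
  ultimately have "(\<Sum>x\<in>A. scale (\<epsilon> (u x)) x) \<in> brackets" by (intro Prim_span_products)
  moreover have "finite A \<longrightarrow> A \<subseteq> X \<longrightarrow> (\<Sum>x\<in>A. scale (\<epsilon> (u x)) x) \<in> brackets \<longrightarrow> (\<forall>x\<in>A. \<epsilon> (u x) = 0)"
    using X unfolding minimal_generators_def by (elim conjE allE)
  ultimately have "\<epsilon> (u x) = 0" using A x by blast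
  moreover have "\<epsilon> (h x) = \<epsilon> (u x)" using M(2)[OF u(2)[of x]] by (simp add: linear_minus[OF functional_counit])
  ultimately show ?thesis by simp
qed

end

section \<open>Words\<close>

context unital_algebra
begin

text \<open>Injectivity of the canonical map from the free algebra on \<open>X\<close>. Sums are
  indexed by words, not by their products, so distinct words must have distinct products.\<close>

definition words_independent :: "'h set \<Rightarrow> bool" where
  "words_independent X \<longleftrightarrow> (\<forall>A c. finite A \<longrightarrow> A \<subseteq> lists X \<longrightarrow>
     (\<Sum>w\<in>A. scale (c w) (prod_list w)) = 0 \<longrightarrow> (\<forall>w\<in>A. c w = 0))"

lemma words_independentD:
  "words_independent X \<Longrightarrow> finite A \<Longrightarrow> A \<subseteq> lists X \<Longrightarrow> (\<Sum>w\<in>A. scale (c w) (prod_list w)) = 0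
    \<Longrightarrow> w \<in> A \<Longrightarrow> c w = 0"
  unfolding words_independent_def by simp

lemma words_independent_inj_on:
  assumes "words_independent X"
  shows "inj_on prod_list (lists X)"
proof (rule inj_onI, rule ccontr)
  fix v w assume vw: "v \<in> lists X" "w \<in> lists X" "prod_list v = prod_list w" "v \<noteq> w"
  then have "(\<Sum>u\<in>{v, w}. scale (if u = v then 1 else -1) (prod_list u)) = 0" by simp
  from words_independentD[OF assms _ _ this, of v] vw show False by simp
qed

lemma words_independent_independent:
  assumes "words_independent X"
  shows "independent (prod_list ` lists X)"
  unfolding independent_explicit_module
proof (intro allI impI)
  fix T u v assume T: "finite T" "T \<subseteq> prod_list ` lists X" "(\<Sum>v\<in>T. scale (u v) v) = 0" and v: "v \<in> T"
  obtain A where A: "A \<subseteq> lists X" "finite A" "T = prod_list ` A"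
    using T(1,2) by (metis finite_subset_image)
  have "inj_on prod_list A" using words_independent_inj_on[OF assms] A(1) by (rule inj_on_subset)
  then have "(\<Sum>w\<in>A. scale (u (prod_list w)) (prod_list w)) = 0"
    using T(3) by (simp add: A(3) sum.reindex)
  moreover obtain w where "w \<in> A" "v = prod_list w" using A v by blast
  ultimately show "u v = 0"
    using words_independentD[OF assms A(2,1), of "\<lambda>w. u (prod_list w)" w] by simp
qed

text \<open>This produces maps given by recursion over words, such as \<open>T\<close> in
  \<open>left_ideal_splits\<close> and the Dynkin operator; outside the span of the words the values
  are arbitrary.\<close>

lemma words_linear_extension:
  assumes "words_independent X" "vector_space s"
  obtains D where "Vector_Spaces.linear scale s D" "\<And>w. w \<in> lists X \<Longrightarrow> D (prod_list w) = g w"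
proof -
  interpret S: vector_space s by fact
  interpret P: vector_space_pair scale s by unfold_locales
  obtain D where D: "Vector_Spaces.linear scale s D"
    "\<forall>x\<in>prod_list ` lists X. D x = g (inv_into (lists X) prod_list x)"
    using P.linear_independent_extend[OF words_independent_independent[OF assms(1)],
        of "\<lambda>x. g (inv_into (lists X) prod_list x)"] by blast
  then show ?thesis
    by (intro that[of D]) (simp_all add: inv_into_f_f[OF words_independent_inj_on[OF assms(1)]])
qed

lemma free_algebra_words:
  assumes "free_algebra scale"
  obtains Y where "words_independent Y" "span (prod_list ` lists Y) = UNIV"
proof -
  obtain Y where Y: "bij_betw (lin_ext scale prod_list) (free_algebra_space Y :: ('h list \<Rightarrow>\<^sub>0 'k) set) UNIV"
    using assms unfolding free_algebra_def by blast
  note V = vector_space_axioms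
  have "words_independent Y"
    unfolding words_independent_def
  proof (intro allI impI ballI)
    fix A c w assume A: "finite A" "A \<subseteq> lists Y" "(\<Sum>w\<in>A. scale (c w) (prod_list w)) = 0" and w: "w \<in> A"
    define p where "p = (\<Sum>w\<in>A. Poly_Mapping.single w (c w))"
    have look: "Poly_Mapping.lookup p v = (if v \<in> A then c v else 0)" for v
      using A(1) by (simp add: p_def lookup_sum lookup_single when_def)
    have "Poly_Mapping.keys p \<subseteq> A" using look by (auto simp: in_keys_iff split: if_splits)
    then have "p \<in> free_algebra_space Y" "0 \<in> free_algebra_space Y"
      using A(2) by (auto simp: free_algebra_space_def)
    moreover have "lin_ext scale prod_list p = lin_ext scale prod_list 0"
      using A(3) by (simp add: p_def lin_ext_sum[OF V] lin_ext_single[OF V] lin_ext_zero[OF V])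
    ultimately have "p = 0" using Y by (auto simp: bij_betw_def inj_on_def)
    then show "c w = 0" using look[of w] w by simp
  qed
  moreover have "x \<in> span (prod_list ` lists Y)" for x
  proof -
    obtain p where "p \<in> free_algebra_space Y" "x = lin_ext scale prod_list p"
      using Y unfolding bij_betw_def by blast
    moreover have "(\<Sum>w\<in>Poly_Mapping.keys p. scale (Poly_Mapping.lookup p w) (prod_list w))
        \<in> span (prod_list ` lists Y)" if "Poly_Mapping.keys p \<subseteq> lists Y"
      by (intro span_sum span_scale span_base) (use that in blast)
    ultimately show ?thesis unfolding lin_ext_def free_algebra_space_def by simp
  qed
  ultimately show ?thesis using that by blast
qed

text \<open>
  Free algebras are hereditary: a left ideal \<open>\<pi> M\<close> that is a quotient of a left module \<open>M\<close> splits off.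
  A linear splitting \<open>g\<close> fails to be a module map by \<open>y (g h) - g (y h)\<close>, and the recursion
  \<open>T (y w) = y (T w) + (y (g w) - g (y w))\<close> on words solves for a correction.
\<close>

lemma left_ideal_splits:
  assumes Y: "words_independent Y" "span (prod_list ` lists Y) = UNIV"
    and s: "vector_space s" and \<pi>: "Vector_Spaces.linear s scale \<pi>"
    and act: "\<And>y. Vector_Spaces.linear s s (act y)" "\<And>y m. \<pi> (act y m) = y * \<pi> m"
  obtains \<sigma> where "Vector_Spaces.linear scale s \<sigma>" "\<And>m. \<pi> (\<sigma> (\<pi> m)) = \<pi> m"
    "\<And>y m. y \<in> Y \<Longrightarrow> \<sigma> (y * \<pi> m) = act y (\<sigma> (\<pi> m))"
proof -
  interpret S: vector_space s by fact
  interpret P: vector_space_pair s scale by unfold_locales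
  obtain g where g: "Vector_Spaces.linear scale s g" "\<And>m. \<pi> (g (\<pi> m)) = \<pi> m"
    using P.linear_exists_right_inverse_on[OF \<pi> S.subspace_UNIV] by auto
  \<comment> \<open>On the image of \<open>\<pi>\<close>, \<open>\<pi> (g h)\<close> is
    \<open>h\<close>. Elsewhere \<open>y * \<pi> (g h)\<close> still lies in the left ideal, so
    \<open>c y h\<close> is in the kernel of \<open>\<pi>\<close> for every
    \<open>h\<close>.\<close>
  define c where "c y h = act y (g h) - g (y * \<pi> (g h))" for y h
  have \<pi>c: "\<pi> (c y h) = 0" for y h
    using g(2)[of "act y (g h)"] by (simp add: c_def linear_minus[OF \<pi>] act(2))
  have clin: "Vector_Spaces.linear scale s (c y)" for y
    unfolding c_def
    by (rule linearI[OF vector_space_axioms s])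
      (simp_all add: linear_plus[OF act(1)] linear_plus[OF g(1)] linear_plus[OF \<pi>] distrib_left
        linear_times[OF act(1)] linear_times[OF g(1)] linear_times[OF \<pi>] scale_mult_right
        S.scale_right_diff_distrib)
  define t where "t = rec_list 0 (\<lambda>y w r. act y r + c y (prod_list w))"
  have t: "t [] = 0" "t (y # w) = act y (t w) + c y (prod_list w)" for y w
    by (simp_all add: t_def)
  obtain T where T: "Vector_Spaces.linear scale s T" "\<And>w. w \<in> lists Y \<Longrightarrow> T (prod_list w) = t w"
    using words_linear_extension[OF Y(1) s] by metis
  have ind: "Q x" if "Q 0" "\<And>c w y. w \<in> lists Y \<Longrightarrow> Q y \<Longrightarrow> Q (scale c (prod_list w) + y)" for Q x
  proof -
    have "x \<in> span (prod_list ` lists Y)" using Y(2) by simp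
    then show ?thesis by (induction rule: span_induct_alt) (use that in auto)
  qed
  have Ty: "T (y * h) = act y (T h) + c y h" if y: "y \<in> Y" for y h
  proof (induction h rule: ind)
    case 1
    show ?case by (simp add: linear_zero[OF T(1)] linear_zero[OF act(1)] linear_zero[OF clin])
  next
    case (2 a w h)
    have "T (y * prod_list w) = act y (T (prod_list w)) + c y (prod_list w)"
      using T(2)[of "y # w"] T(2)[of w] 2 y by (simp add: t)
    then show ?case
      by (simp add: distrib_left scale_mult_right linear_plus[OF T(1)] linear_times[OF T(1)]
          linear_plus[OF act(1)] linear_times[OF act(1)] linear_plus[OF clin] linear_times[OF clin]
          S.scale_right_distrib 2(2))
  qed
  \<comment> \<open>The corrections stay in the kernel of \<open>\<pi>\<close>, so adding
    \<open>T\<close> to \<open>g\<close> preserves the section property.\<close>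
  have \<pi>t: "\<pi> (t w) = 0" for w
    by (induction w) (simp_all add: t linear_zero[OF \<pi>] linear_plus[OF \<pi>] act(2) \<pi>c)
  have \<pi>T: "\<pi> (T h) = 0" for h
    by (induction h rule: ind)
      (simp_all add: linear_zero[OF T(1)] linear_zero[OF \<pi>] linear_plus[OF T(1)] linear_times[OF T(1)]
        linear_plus[OF \<pi>] linear_times[OF \<pi>] T(2) \<pi>t)
  define \<sigma> where "\<sigma> h = g h + T h" for h
  have "Vector_Spaces.linear scale s \<sigma>"
    unfolding \<sigma>_def
    by (rule linearI[OF vector_space_axioms s])
      (simp_all add: linear_plus[OF T(1)] linear_plus[OF g(1)] linear_times[OF T(1)] linear_times[OF g(1)]
        S.scale_right_distrib)
  moreover have "\<pi> (\<sigma> (\<pi> m)) = \<pi> m" for m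
    by (simp add: \<sigma>_def linear_plus[OF \<pi>] \<pi>T g(2))
  moreover have "\<sigma> (y * \<pi> m) = act y (\<sigma> (\<pi> m))" if "y \<in> Y" for y m
    by (simp add: \<sigma>_def Ty[OF that] c_def g(2) linear_plus[OF act(1)])
  ultimately show ?thesis by (rule that)
qed

end

section \<open>Graded Nakayama lemma and independence of words\<close>

context graded_bialgebra
begin

text \<open>Lowest degrees add: \<open>a\<close> starts in degree \<open>i\<close> or later,
  \<open>b\<close> in degree 1 or later.\<close>

lemma hcomp_mult_eq_zero:
  assumes a: "\<And>n. n < i \<Longrightarrow> hcomp n a = 0" and b: "hcomp 0 b = 0" and n: "n < Suc i"
  shows "hcomp n (a * b) = 0"
proof -
  obtain N where N: "a = (\<Sum>k<N. hcomp k a)" by (rule sum_hcomp)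
  obtain M where M: "b = (\<Sum>l<M. hcomp l b)" by (rule sum_hcomp)
  have z: "hcomp n (hcomp k a * hcomp l b) = 0" for k l
  proof (cases "k + l = n \<and> l \<noteq> 0")
    case True
    then have "hcomp k a = 0" using a[of k] n by simp
    then show ?thesis by (simp add: linear_zero[OF endo_hcomp])
  next
    case False
    then show ?thesis
      using b hcomp_homogeneous[OF grade_mult[OF hcomp_mem[of k a] hcomp_mem[of l b]], of n]
      by (cases "l = 0") (auto simp: linear_zero[OF endo_hcomp])
  qed
  have "a * b = (\<Sum>k<N. \<Sum>l<M. hcomp k a * hcomp l b)"
    by (subst N, subst M) (rule sum_product)
  then show ?thesis by (simp only: linear_setsum[OF endo_hcomp] z) simp
qed

lemma hcomp_eq_zero: "(\<And>n. hcomp n x = 0) \<Longrightarrow> x = 0"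
  by (rule sum_hcomp[of x]) simp

end

context graded_connected_bialgebra
begin

text \<open>
  A graded form of Nakayama's lemma. With \<open>\<pi>\<close> the map from the free left module on \<open>X\<close> to \<open>H\<close> and
  \<open>\<sigma>\<close> a splitting of it, \<open>\<sigma> \<pi> - 1\<close> maps the free module into the kernel of \<open>\<pi>\<close>, so it raises the degree of
  coefficients by the hypothesis on relations; but it is \<open>- 1\<close> on that kernel.
\<close>

lemma minimal_relations_trivial:
  assumes fr: "free_algebra scale"
    and min: "\<And>A h x. finite A \<Longrightarrow> A \<subseteq> X \<Longrightarrow> (\<Sum>x\<in>A. h x * x) = 0 \<Longrightarrow> x \<in> A \<Longrightarrow> \<epsilon> (h x) = 0"
    and A: "finite A" "A \<subseteq> X" and rel: "(\<Sum>x\<in>A. h x * x) = 0" and x: "x \<in> A"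
  shows "h x = 0"
proof -
  obtain Y where Y: "words_independent Y" "span (prod_list ` lists Y) = UNIV"
    by (rule free_algebra_words[OF fr])
  define s :: "'k \<Rightarrow> ('h \<Rightarrow>\<^sub>0 'h) \<Rightarrow> ('h \<Rightarrow>\<^sub>0 'h)" where "s c = Poly_Mapping.map (scale c)" for c
  define act :: "'h \<Rightarrow> ('h \<Rightarrow>\<^sub>0 'h) \<Rightarrow> ('h \<Rightarrow>\<^sub>0 'h)" where "act y = Poly_Mapping.map ((*) y)" for y
  \<comment> \<open>The free left module on \<open>X\<close> is modelled by finitely supported
    functions on all of \<open>'h\<close>; \<open>\<pi>\<close> ignores coordinates outside
    \<open>X\<close>, and claims on coefficients are confined to \<open>X\<close>.\<close>
  define \<pi> :: "('h \<Rightarrow>\<^sub>0 'h) \<Rightarrow> 'h" where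
    "\<pi> f = (\<Sum>x\<in>Poly_Mapping.keys f \<inter> X. Poly_Mapping.lookup f x * x)" for f
  have ls [simp]: "Poly_Mapping.lookup (s c f) z = scale c (Poly_Mapping.lookup f z)" for c f z
    by (simp add: s_def Poly_Mapping.map.rep_eq when_def)
  have la [simp]: "Poly_Mapping.lookup (act y f) z = y * Poly_Mapping.lookup f z" for y f z
    by (simp add: act_def Poly_Mapping.map.rep_eq when_def)
  have s: "vector_space s"
    by unfold_locales (auto intro!: poly_mapping_eqI simp: lookup_add scale_left_distrib scale_right_distrib)
  have \<pi>_sup: "\<pi> f = (\<Sum>x\<in>B \<inter> X. Poly_Mapping.lookup f x * x)"
    if "finite B" "Poly_Mapping.keys f \<subseteq> B" for f B
    unfolding \<pi>_def by (rule sum.mono_neutral_left) (use that in \<open>auto simp: in_keys_iff\<close>)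
  have \<pi>: "Vector_Spaces.linear s scale \<pi>"
  proof (rule linearI[OF s vector_space_axioms])
    fix f f' :: "'h \<Rightarrow>\<^sub>0 'h"
    let ?B = "Poly_Mapping.keys f \<union> Poly_Mapping.keys f'"
    show "\<pi> (f + f') = \<pi> f + \<pi> f'"
      using Poly_Mapping.keys_add[of f f']
      by (simp add: \<pi>_sup[of ?B] lookup_add distrib_right sum.distrib)
    fix c
    have "Poly_Mapping.keys (s c f) \<subseteq> Poly_Mapping.keys f" by (auto simp: in_keys_iff)
    then show "\<pi> (s c f) = scale c (\<pi> f)"
      by (simp add: \<pi>_sup[of "Poly_Mapping.keys f"] scale_mult_left scale_sum_right)
  qed
  have act: "Vector_Spaces.linear s s (act y)" for y
    by (rule linearI[OF s s]; rule poly_mapping_eqI) (simp_all add: lookup_add distrib_left scale_mult_right)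
  have \<pi>act: "\<pi> (act y f) = y * \<pi> f" for y f
  proof -
    have "Poly_Mapping.keys (act y f) \<subseteq> Poly_Mapping.keys f" by (auto simp: in_keys_iff)
    then show ?thesis
      by (simp add: \<pi>_sup[of "Poly_Mapping.keys f"] sum_distrib_left mult.assoc)
  qed
  obtain \<sigma> where \<sigma>: "Vector_Spaces.linear scale s \<sigma>" "\<And>m. \<pi> (\<sigma> (\<pi> m)) = \<pi> m"
    "\<And>y m. y \<in> Y \<Longrightarrow> \<sigma> (y * \<pi> m) = act y (\<sigma> (\<pi> m))"
    using left_ideal_splits[OF Y s \<pi> act \<pi>act] by metis
  have \<sigma>_words: "\<sigma> (prod_list w * \<pi> m) = act (prod_list w) (\<sigma> (\<pi> m))" if "w \<in> lists Y" for w m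
    using that
  proof (induction w)
    case Nil
    show ?case by (rule poly_mapping_eqI) simp
  next
    case (Cons y w)
    have "\<sigma> (y * \<pi> (act (prod_list w) m)) = act y (\<sigma> (\<pi> (act (prod_list w) m)))"
      using Cons by (intro \<sigma>(3)) auto
    also have "\<dots> = act y (act (prod_list w) (\<sigma> (\<pi> m)))" using Cons by (simp add: \<pi>act)
    also have "\<dots> = act (prod_list (y # w)) (\<sigma> (\<pi> m))" by (rule poly_mapping_eqI) (simp add: mult.assoc)
    finally show ?case by (simp add: \<pi>act mult.assoc)
  qed
  \<comment> \<open>\<open>\<sigma>\<close> is known to commute with the letters of
    \<open>Y\<close>; words and then linearity give all of \<open>H\<close>.\<close>
  have \<sigma>_act: "\<sigma> (h * \<pi> m) = act h (\<sigma> (\<pi> m))" for h m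
  proof -
    have "h \<in> span (prod_list ` lists Y)" using Y by simp
    then show ?thesis
    proof (induction rule: span_induct_alt)
      case base
      show ?case by (rule poly_mapping_eqI) (simp add: linear_zero[OF \<sigma>(1)])
    next
      case (step c v h)
      then have "\<sigma> (v * \<pi> m) = act v (\<sigma> (\<pi> m))" using \<sigma>_words by auto
      then have "\<sigma> ((scale c v + h) * \<pi> m) = s c (act v (\<sigma> (\<pi> m))) + act h (\<sigma> (\<pi> m))"
        using step(2) by (simp add: distrib_right scale_mult_left linear_plus[OF \<sigma>(1)] linear_times[OF \<sigma>(1)])
      also have "\<dots> = act (scale c v + h) (\<sigma> (\<pi> m))"
        by (rule poly_mapping_eqI) (simp add: lookup_add distrib_right scale_mult_left)
      finally show ?case .
    qed
  qed
  have ker: "\<epsilon> (Poly_Mapping.lookup f z) = 0" if "\<pi> f = 0" "z \<in> X" for f z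
  proof (cases "z \<in> Poly_Mapping.keys f")
    case True
    then show ?thesis
      using min[of "Poly_Mapping.keys f \<inter> X" "Poly_Mapping.lookup f" z] that by (simp add: \<pi>_def)
  next
    case False
    then show ?thesis by (simp add: in_keys_iff linear_zero[OF functional_counit])
  qed
  define e :: "'h \<Rightarrow> ('h \<Rightarrow>\<^sub>0 'h)" where "e z = Poly_Mapping.single z 1" for z
  \<comment> \<open>\<open>N z\<close> lies in the kernel of \<open>\<pi>\<close>, so its
    coefficients at \<open>X\<close> have no part of degree 0.\<close>
  define N where "N z = \<sigma> (\<pi> (e z)) - e z" for z
  have N\<epsilon>: "hcomp 0 (Poly_Mapping.lookup (N z) y) = 0" if "y \<in> X" for y z
    using ker[of "N z" y] that by (simp add: N_def linear_minus[OF \<pi>] \<sigma>(2) hcomp_zero)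
  define k where "k = (\<Sum>z\<in>A. act (h z) (e z))"
  have lk: "Poly_Mapping.lookup k z = (if z \<in> A then h z else 0)" for z
  proof -
    have "Poly_Mapping.lookup k z = (\<Sum>y\<in>A. if y = z then h y else 0)"
      unfolding k_def lookup_sum by (rule sum.cong) (auto simp: e_def lookup_single)
    then show ?thesis using A(1) by simp
  qed
  have "Poly_Mapping.keys k \<subseteq> A" by (auto simp: in_keys_iff lk split: if_splits)
  then have "\<pi> k = (\<Sum>z\<in>A. h z * z)"
    using A by (subst \<pi>_sup[of A]) (auto simp: lk Int_absorb2)
  then have "\<pi> k = 0" using rel by simp
  then have "0 = \<sigma> (\<pi> k)" by (simp add: linear_zero[OF \<sigma>(1)])
  also have "\<dots> = (\<Sum>z\<in>A. act (h z) (\<sigma> (\<pi> (e z))))"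
    by (simp add: k_def linear_setsum[OF \<pi>] linear_setsum[OF \<sigma>(1)] \<pi>act \<sigma>_act)
  also have "\<dots> = k + (\<Sum>z\<in>A. act (h z) (N z))"
    by (simp add: k_def N_def linear_minus[OF act] sum_subtractf)
  finally have k: "k = - (\<Sum>z\<in>A. act (h z) (N z))" by (simp add: eq_neg_iff_add_eq_0)
  have kN: "Poly_Mapping.lookup k y = - (\<Sum>z\<in>A. Poly_Mapping.lookup k z * Poly_Mapping.lookup (N z) y)" for y
  proof -
    have "Poly_Mapping.lookup k y = - (\<Sum>z\<in>A. h z * Poly_Mapping.lookup (N z) y)"
      by (subst k) (simp add: lookup_sum)
    also have "(\<Sum>z\<in>A. h z * Poly_Mapping.lookup (N z) y)
        = (\<Sum>z\<in>A. Poly_Mapping.lookup k z * Poly_Mapping.lookup (N z) y)"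
      by (rule sum.cong) (simp_all add: lk)
    finally show ?thesis .
  qed
  \<comment> \<open>By \<open>kN\<close>, \<open>k\<close> is expressed through its own coefficients
    times coefficients without degree 0 part, so vanishing below degree \<open>j\<close> forces
    vanishing in degree \<open>j\<close>.\<close>
  have "\<forall>n<j. \<forall>y\<in>X. hcomp n (Poly_Mapping.lookup k y) = 0" for j
  proof (induction j)
    case (Suc j)
    show ?case
    proof (intro allI impI ballI)
      fix n y assume n: "n < Suc j" and y: "y \<in> X"
      have "hcomp n (Poly_Mapping.lookup k z * Poly_Mapping.lookup (N z) y) = 0" if "z \<in> A" for z
      proof (rule hcomp_mult_eq_zero[OF _ N\<epsilon>[OF y] n])
        fix m assume "m < j"
        moreover have "z \<in> X" using that A(2) by (rule subsetD[rotated])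
        ultimately show "hcomp m (Poly_Mapping.lookup k z) = 0" using Suc.IH by simp
      qed
      then show "hcomp n (Poly_Mapping.lookup k y) = 0"
        by (subst kN) (simp add: module_hom.neg[OF linear_imp_module_hom[OF endo_hcomp]]
            linear_setsum[OF endo_hcomp])
    qed
  qed simp
  then have "hcomp n (Poly_Mapping.lookup k x) = 0" for n
    using subsetD[OF A(2) x] lessI by metis
  then have "Poly_Mapping.lookup k x = 0" by (rule hcomp_eq_zero)
  then show ?thesis using lk x by simp
qed

text \<open>The induction is on the maximal length of the words: \<open>rel\<close> makes the
  coefficient of each last letter vanish, and this is a relation between shorter words.\<close>

lemma words_independent_of_relations:
  assumes X: "X \<subseteq> \<gg>"
    and rel: "\<And>A h x. finite A \<Longrightarrow> A \<subseteq> X \<Longrightarrow> (\<Sum>x\<in>A. h x * x) = 0 \<Longrightarrow> x \<in> A \<Longrightarrow> h x = 0"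
  shows "words_independent X"
proof -
  have *: "\<forall>w\<in>A. c w = 0" if "finite A" "A \<subseteq> lists X" "\<forall>w\<in>A. length w \<le> n"
      "(\<Sum>w\<in>A. scale (c w) (prod_list w)) = 0" for n A c
    using that
  proof (induction n arbitrary: A c)
    case 0
    then have "A \<subseteq> {[]}" by auto
    then show ?case using 0(4) by (auto simp: subset_singleton_iff)
  next
    case (Suc n)
    let ?A = "A - {[]}"
    \<comment> \<open>Letters have counit 0, so the counit isolates the empty word, which has no
      last letter.\<close>
    have "\<epsilon> (prod_list w) = (if w = [] then 1 else 0)" if "w \<in> lists X" for w
      using that X counit_Prim by (cases w) (auto simp: counit_one counit_mult)
    then have "\<epsilon> (\<Sum>w\<in>A. scale (c w) (prod_list w)) = (\<Sum>w\<in>A. if w = [] then c [] else 0)"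
      unfolding linear_setsum[OF functional_counit]
      by (intro sum.cong[OF refl]) (use Suc.prems(2) in \<open>force simp: counit_scale\<close>)
    then have c0: "[] \<in> A \<Longrightarrow> c [] = 0"
      using Suc.prems(1,4) by (simp add: linear_zero[OF functional_counit])
    then have z: "(\<Sum>w\<in>?A. scale (c w) (prod_list w)) = 0"
      using Suc.prems(1,4) by (cases "[] \<in> A") (simp_all add: sum_diff1)
    define h where "h x = (\<Sum>w\<in>{w\<in>?A. last w = x}. scale (c w) (prod_list (butlast w)))" for x
    have "(\<Sum>x\<in>last ` ?A. h x * x) = (\<Sum>x\<in>last ` ?A. \<Sum>w\<in>{w\<in>?A. last w = x}. scale (c w) (prod_list w))"
    proof (rule sum.cong[OF refl])
      fix x
      have "prod_list w = prod_list (butlast w) * last w" if "w \<in> ?A" for w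
      proof -
        have "w = butlast w @ [last w]" using that by simp
        then have "prod_list w = prod_list (butlast w @ [last w])" by simp
        then show ?thesis by simp
      qed
      then show "h x * x = (\<Sum>w\<in>{w\<in>?A. last w = x}. scale (c w) (prod_list w))"
        unfolding h_def sum_distrib_right by (intro sum.cong) (auto simp: scale_mult_left)
    qed
    also have "\<dots> = (\<Sum>w\<in>?A. scale (c w) (prod_list w))"
      by (rule sum.group) (use Suc.prems(1) in auto)
    finally have "(\<Sum>x\<in>last ` ?A. h x * x) = 0" using z by simp
    moreover have "last ` ?A \<subseteq> X"
    proof (rule image_subsetI)
      fix w assume "w \<in> ?A"
      then have "set w \<subseteq> X" "last w \<in> set w" using Suc.prems(2) by auto
      then show "last w \<in> X" by blast
    qed
    ultimately have h0: "h x = 0" if "x \<in> last ` ?A" for x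
      by (intro rel[of "last ` ?A" h x] that) (simp_all only: Suc.prems(1) finite_Diff finite_imageI)
    show ?case
    proof
      fix w assume w: "w \<in> A"
      show "c w = 0"
      proof (cases "w = []")
        case True
        then show ?thesis using c0 w by simp
      next
        case False
        let ?B = "{v\<in>?A. last v = last w}"
        have bl: "butlast v @ [last w] = v" if "v \<in> ?B" for v
          using that append_butlast_last_id[of v] by auto
        then have inj: "inj_on butlast ?B" by (rule inj_on_inverseI)
        have "(\<Sum>v\<in>butlast ` ?B. scale (c (v @ [last w])) (prod_list v)) = h (last w)"
          unfolding h_def sum.reindex[OF inj] comp_def
          by (rule sum.cong[OF refl]) (simp only: bl)
        also have "\<dots> = 0" by (rule h0, rule imageI) (simp add: w False)
        finally have **: "(\<Sum>v\<in>butlast ` ?B. scale (c (v @ [last w])) (prod_list v)) = 0" .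
        have "\<forall>v\<in>butlast ` ?B. c (v @ [last w]) = 0"
        proof (rule Suc.IH[where A = "butlast ` ?B" and c = "\<lambda>v. c (v @ [last w])"])
          show "finite (butlast ` ?B)" using Suc.prems(1) by simp
          show "butlast ` ?B \<subseteq> lists X" proof (rule image_subsetI)
            fix v assume "v \<in> ?B"
            then have "set v \<subseteq> X" using Suc.prems(2) by blast
            then show "butlast v \<in> lists X" using in_set_butlastD[of _ v] by blast
          qed
          show "\<forall>v\<in>butlast ` ?B. length v \<le> n" proof (rule ballI)
            fix u assume "u \<in> butlast ` ?B"
            then obtain v where "v \<in> A" "u = butlast v" by blast
            then show "length u \<le> n" using Suc.prems(3) by force
          qed
          show "(\<Sum>v\<in>butlast ` ?B. scale (c (v @ [last w])) (prod_list v)) = 0" by (rule **)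
        qed
        moreover have "butlast w \<in> butlast ` ?B" using w False by blast
        ultimately have "c (butlast w @ [last w]) = 0" by blast
        then show ?thesis using append_butlast_last_id[OF False] by simp
      qed
    qed
  qed
  show ?thesis unfolding words_independent_def
  proof (intro allI impI)
    fix A :: "'h list set" and c
    assume A: "finite A" "A \<subseteq> lists X" "(\<Sum>w\<in>A. scale (c w) (prod_list w)) = 0"
    obtain n where "\<forall>w\<in>A. length w \<le> n"
      using A(1) finite_nat_set_iff_bounded_le[of "length ` A"] by auto
    then show "\<forall>w\<in>A. c w = 0" by (rule *[OF A(1,2) _ A(3)])
  qed
qed

end

section \<open>The free Lie algebra inside the free associative algebra\<close>

lemma linear_bilin_ext_left: "Vector_Spaces.linear fscale fscale (\<lambda>p. bilin_ext f p q)"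
  unfolding bilin_ext_eq_lin_ext by (rule linear_lin_ext[OF vector_space_fscale])

lemma linear_bilin_ext_right:
  fixes f :: "'x \<Rightarrow> 'y \<Rightarrow> 'z"
  shows "Vector_Spaces.linear fscale fscale (\<lambda>q :: 'y \<Rightarrow>\<^sub>0 'k::field. bilin_ext f p q)"
proof (rule linearI[OF vector_space_fscale vector_space_fscale])
  interpret F: vector_space "fscale :: 'k \<Rightarrow> ('z \<Rightarrow>\<^sub>0 'k) \<Rightarrow> _" by (rule vector_space_fscale)
  fix q q' :: "'y \<Rightarrow>\<^sub>0 'k" and c :: 'k
  show "bilin_ext f p (q + q') = bilin_ext f p q + bilin_ext f p q'"
    by (simp add: bilin_ext_eq_lin_ext lin_ext_add[OF vector_space_fscale] lin_ext_plus[OF vector_space_fscale])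
  show "bilin_ext f p (fscale c q) = fscale c (bilin_ext f p q)"
    by (simp add: bilin_ext_eq_lin_ext lin_ext_fscale[OF vector_space_fscale]
        lin_ext_comp[OF F.linear_scale_self])
qed

lemma bilin_ext_bas: "bilin_ext f (bas x) (bas y) = bas (f x y)"
  by (rule poly_mapping_eqI)
    (simp add: bilin_ext_bas_left lin_ext_single[OF vector_space_fscale])

lemma free_magma_algebra_mult:
  assumes "p \<in> free_magma_algebra X" "q \<in> free_magma_algebra X"
  shows "mag_mult p q \<in> free_magma_algebra X"
  using assms keys_bilin_ext[of Br p q] unfolding free_magma_algebra_def by fastforce

lemma subspace_free_magma_algebra:
  "module.subspace fscale (free_magma_algebra X :: ('x magma \<Rightarrow>\<^sub>0 'k::field) set)"
proof -
  interpret F: vector_space "fscale :: 'k \<Rightarrow> ('x magma \<Rightarrow>\<^sub>0 'k) \<Rightarrow> _" by (rule vector_space_fscale)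
  show ?thesis unfolding F.subspace_def
  proof (intro conjI ballI allI)
    show "0 \<in> free_magma_algebra X" by (simp add: free_magma_algebra_def)
    fix p q :: "'x magma \<Rightarrow>\<^sub>0 'k" assume "p \<in> free_magma_algebra X" "q \<in> free_magma_algebra X"
    then show "p + q \<in> free_magma_algebra X"
      using Poly_Mapping.keys_add[of p q] unfolding free_magma_algebra_def by blast
  next
    fix c and p :: "'x magma \<Rightarrow>\<^sub>0 'k" assume "p \<in> free_magma_algebra X"
    then show "fscale c p \<in> free_magma_algebra X"
      by (auto simp: free_magma_algebra_def in_keys_iff)
  qed
qed

lemma bas_free_magma_algebra: "set_magma t \<subseteq> X \<Longrightarrow> bas t \<in> free_magma_algebra X"
  by (simp add: free_magma_algebra_def)

lemma subspace_lie_ideal: "module.subspace fscale (lie_ideal X :: ('x magma \<Rightarrow>\<^sub>0 'k::field) set)"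
proof -
  interpret F: vector_space "fscale :: 'k \<Rightarrow> ('x magma \<Rightarrow>\<^sub>0 'k) \<Rightarrow> _" by (rule vector_space_fscale)
  show ?thesis unfolding F.subspace_def
    by (blast intro: lie_ideal.zero lie_ideal.add lie_ideal.scale)
qed

text \<open>Polarisation of the alternating law at \<open>a + b\<close>.\<close>

lemma lie_ideal_antisym:
  fixes a b :: "'x magma \<Rightarrow>\<^sub>0 'k::field"
  assumes "a \<in> free_magma_algebra X" "b \<in> free_magma_algebra X"
  shows "mag_mult a b + mag_mult b a \<in> lie_ideal X"
proof -
  interpret F: vector_space "fscale :: 'k \<Rightarrow> ('x magma \<Rightarrow>\<^sub>0 'k) \<Rightarrow> _" by (rule vector_space_fscale)
  have "a + b \<in> free_magma_algebra X"
    using F.subspace_add[OF subspace_free_magma_algebra] assms by blast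
  then have "mag_mult (a + b) (a + b) - mag_mult a a - mag_mult b b \<in> lie_ideal X"
    using assms by (intro F.subspace_diff[OF subspace_lie_ideal] lie_ideal.alternating)
  then show ?thesis
    by (simp add: linear_plus[OF linear_bilin_ext_left] linear_plus[OF linear_bilin_ext_right] algebra_simps)
qed

text \<open>The right adjoint action on the free Lie algebra is a representation.\<close>

lemma lie_ideal_jacobi:
  fixes a t u :: "'x magma \<Rightarrow>\<^sub>0 'k::field"
  assumes "a \<in> free_magma_algebra X" "t \<in> free_magma_algebra X" "u \<in> free_magma_algebra X"
  shows "mag_mult (mag_mult a t) u - mag_mult (mag_mult a u) t - mag_mult a (mag_mult t u) \<in> lie_ideal X"
proof -
  interpret F: vector_space "fscale :: 'k \<Rightarrow> ('x magma \<Rightarrow>\<^sub>0 'k) \<Rightarrow> _" by (rule vector_space_fscale)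
  note add = F.subspace_add[OF subspace_lie_ideal] and diff = F.subspace_diff[OF subspace_lie_ideal]
  note fm = assms free_magma_algebra_mult
  have 1: "mag_mult a (mag_mult t u) + mag_mult t (mag_mult u a) + mag_mult u (mag_mult a t) \<in> lie_ideal X"
    by (rule lie_ideal.jacobi) (fact assms)+
  have 2: "mag_mult (mag_mult a t) u + mag_mult u (mag_mult a t) \<in> lie_ideal X"
    by (intro lie_ideal_antisym fm)
  have 3: "mag_mult t (mag_mult u a) + mag_mult (mag_mult u a) t \<in> lie_ideal X"
    by (intro lie_ideal_antisym fm)
  have 4: "mag_mult (mag_mult u a + mag_mult a u) t \<in> lie_ideal X"
    by (intro lie_ideal.mult_right lie_ideal_antisym fm)
  from add[OF diff[OF 2 1] diff[OF 3 4]]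
  show ?thesis by (simp add: linear_plus[OF linear_bilin_ext_left] algebra_simps)
qed

fun left_normed :: "'x list \<Rightarrow> 'x magma" where
  "left_normed [] = undefined"
| "left_normed (x # w) = foldl (\<lambda>t y. Br t (Gen y)) (Gen x) w"

lemma left_normed_snoc: "w \<noteq> [] \<Longrightarrow> left_normed (w @ [x]) = Br (left_normed w) (Gen x)"
  by (cases w) auto

lemma set_left_normed: "w \<noteq> [] \<Longrightarrow> set_magma (left_normed w) = set w"
  by (induction w rule: rev_nonempty_induct) (auto simp: left_normed_snoc)

primrec leaves :: "'x magma \<Rightarrow> nat" where
  "leaves (Gen x) = 1"
| "leaves (Br t u) = leaves t + leaves u"

lemma leaves_pos: "leaves t > 0"
  by (induction t) auto

section \<open>Evaluation of the free nonassociative algebra by commutators\<close>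

context unital_algebra
begin

abbreviation lie_eval :: "'h magma \<Rightarrow> 'h" where
  "lie_eval \<equiv> magma_eval (\<lambda>x y. x * y - y * x)"

lemma lin_ext_eval_mult:
  "lin_ext scale lie_eval (mag_mult p q)
    = lin_ext scale lie_eval p * lin_ext scale lie_eval q - lin_ext scale lie_eval q * lin_ext scale lie_eval p"
proof -
  note V = vector_space_axioms
  let ?e = "lin_ext scale lie_eval"
  have r: "Vector_Spaces.linear scale scale (\<lambda>y. x * y - y * x)" for x
    by (rule linearI[OF V V]) (simp_all add: algebra_simps scale_mult_left scale_mult_right scale_right_diff_distrib)
  have l: "Vector_Spaces.linear scale scale (\<lambda>x. x * y - y * x)" for y
    by (rule linearI[OF V V]) (simp_all add: algebra_simps scale_mult_left scale_mult_right scale_right_diff_distrib)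
  have "?e (mag_mult p q) = lin_ext scale (\<lambda>x. lin_ext scale (\<lambda>y. lie_eval x * lie_eval y - lie_eval y * lie_eval x) q) p"
    by (simp add: lin_ext_bilin_ext[OF V])
  also have "\<dots> = lin_ext scale (\<lambda>x. lie_eval x * ?e q - ?e q * lie_eval x) p"
    by (simp add: lin_ext_comp[OF r])
  also have "\<dots> = ?e p * ?e q - ?e q * ?e p"
    by (simp add: lin_ext_comp[OF l])
  finally show ?thesis .
qed

lemma lie_ideal_subset_kernel:
  "p \<in> lie_ideal X \<Longrightarrow> p \<in> free_magma_algebra X \<and> lin_ext scale lie_eval p = 0"
proof (induction rule: lie_ideal.induct)
  interpret F: vector_space "fscale :: 'k \<Rightarrow> ('h magma \<Rightarrow>\<^sub>0 'k) \<Rightarrow> _" by (rule vector_space_fscale)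
  note V = vector_space_axioms
  note s = subspace_free_magma_algebra
  {
    case (alternating a)
    then show ?case by (simp add: lin_ext_eval_mult free_magma_algebra_mult)
  next
    case (jacobi a b c)
    then show ?case
      by (simp add: lin_ext_eval_mult free_magma_algebra_mult F.subspace_add[OF s] lin_ext_add[OF V])
        (simp add: algebra_simps)
  next
    case zero
    then show ?case by (simp add: F.subspace_0[OF s] lin_ext_zero[OF V])
  next
    case (add p q)
    then show ?case by (simp add: F.subspace_add[OF s] lin_ext_add[OF V])
  next
    case (scale p c)
    then show ?case by (simp add: F.subspace_scale[OF s] lin_ext_fscale[OF V])
  next
    case (mult_left a p)
    then show ?case by (simp add: lin_ext_eval_mult free_magma_algebra_mult)
  next
    case (mult_right a p)
    then show ?case by (simp add: lin_ext_eval_mult free_magma_algebra_mult)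
  }
qed

end

locale unital_algebra_char_0 = unital_algebra scale
  for scale :: "'k::field_char_0 \<Rightarrow> 'h::ring_1 \<Rightarrow> 'h"
begin

text \<open>
  Dynkin, Specht and Wever: the map \<open>D\<close> sending a word to its left-normed bracket satisfies
  \<open>D (h (lie_eval t)) = [D h, t]\<close>, hence multiplies elements of degree \<open>n\<close> of the free Lie algebra by \<open>n\<close>.
\<close>

lemma kernel_subset_lie_ideal:
  assumes X: "words_independent X"
    and p: "p \<in> free_magma_algebra X" "lin_ext scale lie_eval p = 0"
  shows "p \<in> lie_ideal X"
proof -
  interpret F: vector_space "fscale :: 'k \<Rightarrow> ('h magma \<Rightarrow>\<^sub>0 'k) \<Rightarrow> _" by (rule vector_space_fscale)
  note V = vector_space_axioms and FV = vector_space_fscale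
  note add = F.subspace_add[OF subspace_lie_ideal] and diff = F.subspace_diff[OF subspace_lie_ideal]
    and sc = F.subspace_scale[OF subspace_lie_ideal]
  note ml = linear_plus[OF linear_bilin_ext_left] linear_times[OF linear_bilin_ext_left]
    linear_minus[OF linear_bilin_ext_left]
  obtain D where D: "Vector_Spaces.linear scale fscale D"
      "\<And>w. w \<in> lists X \<Longrightarrow> D (prod_list w) = (bas (left_normed w) :: 'h magma \<Rightarrow>\<^sub>0 'k)"
    using words_linear_extension[OF X FV, of "\<lambda>w. bas (left_normed w)"] by metis
  \<comment> \<open>Dividing \<open>D\<close> by the word length makes \<open>E\<close> invert
    evaluation modulo the ideal in all degrees at once, so \<open>p\<close> need not be split into
    homogeneous parts. At the empty word the factor is \<open>1 / 0 = 0\<close>.\<close>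
  obtain E where E: "Vector_Spaces.linear scale fscale E"
      "\<And>w. w \<in> lists X \<Longrightarrow> E (prod_list w) = (fscale (1 / of_nat (length w)) (bas (left_normed w)) :: 'h magma \<Rightarrow>\<^sub>0 'k)"
    using words_linear_extension[OF X FV, of "\<lambda>w. fscale (1 / of_nat (length w)) (bas (left_normed w))"] by metis
  define W where "W n = span (prod_list ` {w \<in> lists X. length w = n})" for n
  have sW: "subspace (W n)" for n unfolding W_def by (rule subspace_span)
  have Wmult: "x * y \<in> W (m + n)" if x: "x \<in> W m" and y: "y \<in> W n" for x y m n
  proof -
    have 1: "prod_list w * y \<in> W (m + n)" if w: "w \<in> lists X" "length w = m" for w
      using y unfolding W_def
    proof (induction rule: span_induct_alt)
      case (step c z y)
      then obtain v where v: "v \<in> lists X" "length v = n" "z = prod_list v" by blast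
      have "prod_list (w @ v) \<in> span (prod_list ` {w \<in> lists X. length w = m + n})"
        by (intro span_base imageI) (use v w in simp)
      then show ?case using step(2) v(3) by (simp add: distrib_left scale_mult_right span_add span_scale)
    qed (simp add: span_zero)
    show ?thesis using x unfolding W_def[of m]
    proof (induction rule: span_induct_alt)
      case (step c z x)
      then have "z * y \<in> W (m + n)" using 1 by blast
      then show ?case using step(2)
        by (simp add: distrib_right scale_mult_left subspace_add[OF sW] subspace_scale[OF sW])
    qed (simp add: subspace_0[OF sW])
  qed
  have evalW: "lie_eval t \<in> W (leaves t)" if "set_magma t \<subseteq> X" for t
    using that
  proof (induction t)
    case (Gen x)
    have "prod_list [x] \<in> W 1" unfolding W_def by (intro span_base imageI) (use Gen in simp)
    then show ?case by simp
  next
    case (Br t u)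
    then have "lie_eval t \<in> W (leaves t)" "lie_eval u \<in> W (leaves u)" by auto
    then show ?case
      using Wmult[of "lie_eval t" "leaves t" "lie_eval u" "leaves u"] Wmult[of "lie_eval u" "leaves u" "lie_eval t" "leaves t"]
      by (simp add: add.commute subspace_diff[OF sW])
  qed
  \<comment> \<open>The condition \<open>n > 0\<close> excludes the empty word, whose left-normed
    bracket is \<open>undefined\<close>.\<close>
  have DW: "D h \<in> free_magma_algebra X" if "h \<in> W n" "n > 0" for h n
    using that(1) unfolding W_def
  proof (induction rule: span_induct_alt)
    case base
    show ?case by (simp add: linear_zero[OF D(1)] F.subspace_0[OF subspace_free_magma_algebra])
  next
    case (step c x y)
    then obtain w where w: "w \<in> lists X" "length w = n" "x = prod_list w" by blast
    then have "set_magma (left_normed w) \<subseteq> X" using that(2) by (subst set_left_normed) auto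
    then have "D x \<in> free_magma_algebra X" using w D(2) by (simp add: bas_free_magma_algebra)
    then show ?case using step(2)
      by (simp add: linear_plus[OF D(1)] linear_times[OF D(1)]
          F.subspace_add[OF subspace_free_magma_algebra] F.subspace_scale[OF subspace_free_magma_algebra])
  qed
  have Dmult: "D (h * lie_eval t) - mag_mult (D h) (bas t) \<in> lie_ideal X"
    if "set_magma t \<subseteq> X" "h \<in> W n" "n > 0" for t h n
    using that
  proof (induction t arbitrary: h n)
    case (Gen x)
    have "D (h * x) = mag_mult (D h) (bas (Gen x))"
      using Gen(2) unfolding W_def
    proof (induction rule: span_induct_alt)
      case base
      show ?case by (simp add: linear_zero[OF D(1)] linear_zero[OF linear_bilin_ext_left])
    next
      case (step c y h)
      then obtain w where w: "w \<in> lists X" "length w = n" "y = prod_list w" by blast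
      have "D (y * x) = D (prod_list (w @ [x]))" using w by simp
      also have "\<dots> = bas (left_normed (w @ [x]))" by (rule D(2)) (use w Gen in simp)
      also have "\<dots> = mag_mult (bas (left_normed w)) (bas (Gen x))"
        using w Gen(3) by (subst left_normed_snoc) (auto simp: bilin_ext_bas)
      also have "\<dots> = mag_mult (D y) (bas (Gen x))" using w D(2) by simp
      finally show ?case using step(2)
        by (simp add: distrib_right scale_mult_left linear_plus[OF D(1)] linear_times[OF D(1)] ml)
    qed
    then show ?case by (simp add: lie_ideal.zero)
  next
    case (Br t u)
    let ?a = "D h" and ?t = "bas t :: 'h magma \<Rightarrow>\<^sub>0 'k" and ?u = "bas u :: 'h magma \<Rightarrow>\<^sub>0 'k"
    have tX: "set_magma t \<subseteq> X" and uX: "set_magma u \<subseteq> X" using Br by auto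
    have a: "?a \<in> free_magma_algebra X" by (rule DW[OF Br(4,5)])
    have tu: "?t \<in> free_magma_algebra X" "?u \<in> free_magma_algebra X"
      using tX uX by (auto intro: bas_free_magma_algebra)
    have ht: "h * lie_eval t \<in> W (n + leaves t)" and hu: "h * lie_eval u \<in> W (n + leaves u)"
      using Wmult[OF Br(4) evalW] tX uX by auto
    have 1: "D (h * lie_eval t * lie_eval u) - mag_mult (D (h * lie_eval t)) ?u \<in> lie_ideal X"
      using Br(2)[OF uX ht] Br(5) by simp
    have 2: "D (h * lie_eval u * lie_eval t) - mag_mult (D (h * lie_eval u)) ?t \<in> lie_ideal X"
      using Br(1)[OF tX hu] Br(5) by simp
    have 3: "mag_mult (D (h * lie_eval t) - mag_mult ?a ?t) ?u \<in> lie_ideal X"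
      by (rule lie_ideal.mult_right[OF tu(2) Br(1)[OF tX Br(4,5)]])
    have 4: "mag_mult (D (h * lie_eval u) - mag_mult ?a ?u) ?t \<in> lie_ideal X"
      by (rule lie_ideal.mult_right[OF tu(1) Br(2)[OF uX Br(4,5)]])
    have 5: "mag_mult (mag_mult ?a ?t) ?u - mag_mult (mag_mult ?a ?u) ?t - mag_mult ?a (mag_mult ?t ?u) \<in> lie_ideal X"
      by (rule lie_ideal_jacobi[OF a tu])
    \<comment> \<open>The induction hypotheses serve for \<open>h\<close> and also for
      \<open>h * lie_eval t\<close> and \<open>h * lie_eval u\<close>, hence the arbitrary
      \<open>h\<close> and \<open>n\<close>. \<open>lie_ideal_jacobi\<close> joins the two iterated
      actions into that of \<open>Br t u\<close>.\<close>
    have "D (h * lie_eval (Br t u)) = D (h * lie_eval t * lie_eval u) - D (h * lie_eval u * lie_eval t)"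
      by (simp add: right_diff_distrib mult.assoc linear_minus[OF D(1)])
    with add[OF diff[OF add[OF 1 3] add[OF 2 4]] 5] show ?case
      by (simp add: ml bilin_ext_bas)
  qed
  \<comment> \<open>\<open>Dmult\<close> does not cover \<open>h = 1\<close>, so the tree is split
    at its root: modulo the ideal \<open>D\<close> gives \<open>[D t, u] - [D u, t]\<close>, and
    induction with antisymmetry turns this into \<open>leaves t + leaves u\<close> times the
    bracket.\<close>
  have Deval: "D (lie_eval t) - fscale (of_nat (leaves t)) (bas t) \<in> lie_ideal X" if "set_magma t \<subseteq> X" for t
    using that
  proof (induction t)
    case (Gen x)
    have "D (prod_list [x]) = bas (left_normed [x])" by (rule D(2)) (use Gen in simp)
    then show ?case by (simp add: lie_ideal.zero)
  next
    case (Br t u)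
    let ?t = "bas t :: 'h magma \<Rightarrow>\<^sub>0 'k" and ?u = "bas u :: 'h magma \<Rightarrow>\<^sub>0 'k"
    have tX: "set_magma t \<subseteq> X" and uX: "set_magma u \<subseteq> X" using Br by auto
    have tu: "?t \<in> free_magma_algebra X" "?u \<in> free_magma_algebra X"
      using tX uX by (auto intro: bas_free_magma_algebra)
    have 1: "D (lie_eval t * lie_eval u) - mag_mult (D (lie_eval t)) ?u \<in> lie_ideal X"
      by (rule Dmult[OF uX evalW[OF tX] leaves_pos])
    have 2: "D (lie_eval u * lie_eval t) - mag_mult (D (lie_eval u)) ?t \<in> lie_ideal X"
      by (rule Dmult[OF tX evalW[OF uX] leaves_pos])
    have 3: "mag_mult (D (lie_eval t) - fscale (of_nat (leaves t)) ?t) ?u \<in> lie_ideal X"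
      by (rule lie_ideal.mult_right[OF tu(2) Br(1)[OF tX]])
    have 4: "mag_mult (D (lie_eval u) - fscale (of_nat (leaves u)) ?u) ?t \<in> lie_ideal X"
      by (rule lie_ideal.mult_right[OF tu(1) Br(2)[OF uX]])
    have 5: "fscale (of_nat (leaves u)) (mag_mult ?t ?u + mag_mult ?u ?t) \<in> lie_ideal X"
      by (intro sc lie_ideal_antisym tu)
    have "D (lie_eval (Br t u)) = D (lie_eval t * lie_eval u) - D (lie_eval u * lie_eval t)"
      by (simp add: linear_minus[OF D(1)])
    then have "D (lie_eval (Br t u)) - fscale (of_nat (leaves (Br t u))) (bas (Br t u))
        = D (lie_eval t * lie_eval u) - mag_mult (D (lie_eval t)) ?u
          + mag_mult (D (lie_eval t) - fscale (of_nat (leaves t)) ?t) ?u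
          - (D (lie_eval u * lie_eval t) - mag_mult (D (lie_eval u)) ?t
          + mag_mult (D (lie_eval u) - fscale (of_nat (leaves u)) ?u) ?t)
          - fscale (of_nat (leaves u)) (mag_mult ?t ?u + mag_mult ?u ?t)"
      by (simp only: ml bilin_ext_bas F.scale_right_distrib F.scale_left_distrib leaves.simps of_nat_add)
        (simp add: algebra_simps)
    with diff[OF diff[OF add[OF 1 3] add[OF 2 4]] 5] show ?case by simp
  qed
  have ED: "E h = fscale (1 / of_nat n) (D h)" if "h \<in> W n" for h n
    using that unfolding W_def
  proof (induction rule: span_induct_alt)
    case base
    show ?case by (simp add: linear_zero[OF D(1)] linear_zero[OF E(1)])
  next
    case (step c x y)
    then obtain w where w: "w \<in> lists X" "length w = n" "x = prod_list w" by blast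
    then have "E x = fscale (1 / of_nat n) (D x)" using D(2) E(2) by simp
    then show ?case using step(2)
      by (simp add: linear_plus[OF D(1)] linear_times[OF D(1)] linear_plus[OF E(1)] linear_times[OF E(1)]
          F.scale_right_distrib mult.commute)
  qed
  have Eeval: "E (lie_eval t) - bas t \<in> lie_ideal X" if t: "set_magma t \<subseteq> X" for t
  proof -
    have "fscale (1 / of_nat (leaves t)) (D (lie_eval t) - fscale (of_nat (leaves t)) (bas t)) \<in> lie_ideal X"
      by (rule sc[OF Deval[OF t]])
    moreover have "(of_nat (leaves t) :: 'k) \<noteq> 0" using leaves_pos[of t] by simp
    ultimately show ?thesis by (simp add: ED[OF evalW[OF t]] F.scale_right_diff_distrib)
  qed
  \<comment> \<open>\<open>E\<close> sends the value of \<open>p\<close> back to \<open>p\<close>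
    modulo the ideal, while that value is 0.\<close>
  have "E (lin_ext scale lie_eval p) - p
      = (\<Sum>t\<in>Poly_Mapping.keys p. fscale (Poly_Mapping.lookup p t) (E (lie_eval t) - bas t))"
  proof -
    have "E (lin_ext scale lie_eval p) = (\<Sum>t\<in>Poly_Mapping.keys p. fscale (Poly_Mapping.lookup p t) (E (lie_eval t)))"
      unfolding lin_ext_comp[OF E(1)] by (simp only: lin_ext_def)
    then show ?thesis
      by (simp only: F.scale_right_diff_distrib sum_subtractf poly_mapping_fscale_sum[of p, symmetric])
  qed
  moreover have "\<dots> \<in> lie_ideal X"
    using p(1) by (intro F.subspace_sum[OF subspace_lie_ideal] sc Eeval) (auto simp: free_magma_algebra_def)
  ultimately have "- p \<in> lie_ideal X" using p(2) by (simp add: linear_zero[OF E(1)])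
  then show ?thesis using F.subspace_neg[OF subspace_lie_ideal] by fastforce
qed

end

sublocale graded_connected_bialgebra_char_0 \<subseteq> unital_algebra_char_0 ..

section \<open>Freeness of the primitive elements on minimal generators\<close>

lemma (in graded_connected_bialgebra_char_0) free_lie_algebra_on_minimal_generators:
  assumes "free_algebra scale" and X: "minimal_generators X"
  shows "free_lie_algebra_on scale (\<lambda>x y. x * y - y * x) \<gg> X"
proof -
  interpret F: vector_space "fscale :: 'k \<Rightarrow> ('h magma \<Rightarrow>\<^sub>0 'k) \<Rightarrow> _" by (rule vector_space_fscale)
  note V = vector_space_axioms
  let ?e = "lin_ext scale lie_eval" and ?M = "free_magma_algebra X :: ('h magma \<Rightarrow>\<^sub>0 'k) set"
  have Xg: "X \<subseteq> \<gg>" using X by (auto simp: minimal_generators_def)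
  have "words_independent X"
  proof (rule words_independent_of_relations[OF Xg])
    fix A h x assume A: "finite A" "A \<subseteq> X" "(\<Sum>x\<in>A. h x * x) = 0" "x \<in> A"
    show "h x = 0"
    proof (rule minimal_relations_trivial[where X = X and A = A and h = h and x = x, OF assms(1) _ A])
      fix A h x assume "finite A" "A \<subseteq> X" "(\<Sum>x\<in>A. h x * x) = 0" "x \<in> A"
      then show "\<epsilon> (h x) = 0" by (rule minimal_generators_relation[where h = h and x = x, OF X])
    qed
  qed
  then have ker: "{p \<in> ?M. ?e p = 0} = lie_ideal X"
    by (intro set_eqI iffI CollectI lie_ideal_subset_kernel) (auto intro: kernel_subset_lie_ideal)
  have "lie_eval t \<in> \<gg>" if "set_magma t \<subseteq> X" for t
    using that by (induction t) (use Xg Prim_bracket in auto)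
  then have img: "?e p \<in> \<gg>" if "p \<in> ?M" for p
    unfolding lin_ext_def
    by (intro subspace_sum[OF subspace_Prim] subspace_scale[OF subspace_Prim])
      (use that in \<open>auto simp: free_magma_algebra_def\<close>)
  have "\<gg> \<subseteq> ?e ` ?M"
  proof (rule minimal_generators_generate[OF X])
    show "subspace (?e ` ?M)"
      using module_hom.subspace_image[OF linear_imp_module_hom[OF linear_lin_ext[OF V]] subspace_free_magma_algebra] .
    show "X \<subseteq> ?e ` ?M"
    proof
      fix x assume "x \<in> X"
      then have "bas (Gen x) \<in> ?M" by (simp add: bas_free_magma_algebra)
      moreover have "?e (bas (Gen x)) = x" by (simp add: lin_ext_single[OF V])
      ultimately show "x \<in> ?e ` ?M" by (intro image_eqI[of _ _ "bas (Gen x)"]) simp_all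
    qed
    fix x y assume "x \<in> ?e ` ?M" "y \<in> ?e ` ?M"
    then obtain p q where "p \<in> ?M" "q \<in> ?M" and xy: "x = ?e p" "y = ?e q" by (elim imageE)
    then have "mag_mult p q \<in> ?M" by (intro free_magma_algebra_mult)
    then show "x * y - y * x \<in> ?e ` ?M" unfolding xy lin_ext_eval_mult[symmetric] by (rule imageI)
  qed
  then have "?e ` ?M = \<gg>" by (intro equalityI image_subsetI img)
  with ker show ?thesis unfolding free_lie_algebra_on_def by (intro conjI)
qed

theorem theorem4p1:
  fixes scale :: "'k::field_char_0 \<Rightarrow> 'h::ring_1 \<Rightarrow> 'h"
    and \<Delta> :: "'h \<Rightarrow> ('k, 'h, 'h) tensor"
    and \<epsilon> :: "'h \<Rightarrow> 'k"
    and H :: "nat \<Rightarrow> 'h set"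
  assumes "graded_connected_bialgebra scale \<Delta> \<epsilon> H"
    and "free_algebra scale"
  shows "free_lie_algebra scale (\<lambda>x y. x * y - y * x) (Prim scale \<Delta>)"
proof -
  interpret graded_connected_bialgebra scale \<Delta> \<epsilon> H by fact
  interpret graded_connected_bialgebra_char_0 scale \<Delta> \<epsilon> H ..
  obtain X where "minimal_generators X" using minimal_generators_exist by blast
  from free_lie_algebra_on_minimal_generators[OF assms(2) this] show ?thesis
    unfolding free_lie_algebra_def by blast
qed

end
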